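(* Let $\mathbb D\subset\mathbb C$ be a simply connected domain and let $F:\mathbb D\to\mathrm U\mathbb H^3=\mathrm{SL}_2\mathbb C/\mathrm U_1$ be a Legendre harmonic map with frame $\Phi:\mathbb D\to\mathrm{SL}_2\mathbb C$. Let $\alpha=\Phi^{-1}\mathrm d\Phi=\alpha_{\mathfrak h}+\alpha_{\mathfrak p}$ be the decomposition according to $\mathfrak{sl}_2\mathbb C=\mathfrak h\oplus\mathfrak p$, and let $\alpha_{\mathfrak p}'$ and $\alpha_{\mathfrak p}''$ be the $(1,0)$-part and $(0,1)$-part of $\alpha_{\mathfrak p}$. Then $$\alpha_\lambda=\alpha_{\mathfrak h}+\lambda^{-1}\alpha_{\mathfrak p}'+\lambda\,\alpha_{\mathfrak p}''$$ satisfies $$\mathrm d\alpha_\lambda+\tfrac12[\alpha_\lambda\wedge\alpha_\lambda]=0\qquad\text{for all }\lambda\in\mathbb C^\times.$$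
   Context: $\mathrm{Her}_2\mathbb C$ denotes Hermitian $2\times2$ matrices with Lorentzian scalar product determined by $\langle\xi,\xi\rangle=-\det\xi$; $\mathbb H^3=\{\xi:\det\xi=1,\mathrm{tr}\,\xi>0\}$. Put $e_0=\mathrm{Id}$, $e_1=\mathrm{diag}(1,-1)$. The unit tangent sphere bundle is $\mathrm U\mathbb H^3=\{(x,v)\in\mathrm{Her}_2\mathbb C\times\mathrm{Her}_2\mathbb C:x\in\mathbb H^3,\ \langle v,v\rangle=1,\ \langle x,v\rangle=0\}$. $\mathrm{SL}_2\mathbb C$ (viewed as a real Lie group) acts transitively by $g\cdot(x,v)=(gxg^*,gvg^* )$, $g^*=\bar g^t$, with isotropy group at $(e_0,e_1)$ equal to $\mathrm U_1=\{\mathrm{diag}(e^{i\theta},e^{-i\theta})\}$. A frame of $F$ is a smooth map $\Phi$ with $F=(\Phi\Phi^*,\Phi e_1\Phi^* )$. $\mathfrak h=\mathbb R\,(ie_1)$ is the Lie algebra of $\mathrm U_1$ and $\mathfrak p$ is its orthogonal complement in $\mathfrak{sl}_2\mathbb C$, i.e. the matrices in $\mathfrak{sl}_2\mathbb C$ with real diagonal entries. The $(1,0)$/$(0,1)$-parts of an $\mathfrak{sl}_2\mathbb C$-valued 1-form $A\,\mathrm dz+B\,\mathrm d\bar z$ are $A\,\mathrm dz$ and $B\,\mathrm d\bar z$ (ordinary matrix coefficients). The contact form $\omega$ on $\mathrm U\mathbb H^3$ is $\omega_{(x,v)}(X,V)=\langle X,v\rangle$; $F$ is Legendre if $F^*\omega=0$.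 Harmonicity is with respect to the $\mathrm{SL}_2\mathbb C$-invariant semi-Riemannian metric on $\mathrm{SL}_2\mathbb C/\mathrm U_1$ induced on $\mathfrak p$ by (a constant multiple of) the invariant scalar product $\frac12\mathrm{Re}\,\mathrm{tr}(XY)$ on $\mathfrak{sl}_2\mathbb C$; equivalently, $\mathrm d( *\alpha_{\mathfrak p})+[\alpha\wedge *\alpha_{\mathfrak p}]=0$ with $*$ the Hodge star of $\mathbb D$. *)

theory Defs
  imports "HOL-Analysis.Analysis"
begin

section \<open>Smooth maps on open subsets of Euclidean spaces\<close>

text \<open>Intended for open \<open>S\<close>: all iterated partial derivatives of order at most \<open>k\<close>
  exist and are continuous. Smoothness is real (\<open>C\<^sup>\<infinity>\<close>) smoothness also when the
  domain is the complex plane.\<close>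

primrec C_k_on :: "nat \<Rightarrow> 'a::euclidean_space set \<Rightarrow> ('a \<Rightarrow> 'b::real_normed_vector) \<Rightarrow> bool" where
  "C_k_on 0 S f \<longleftrightarrow> continuous_on S f"
| "C_k_on (Suc k) S f \<longleftrightarrow>
     (\<forall>x\<in>S. f differentiable at x) \<and>
     (\<forall>b\<in>Basis. C_k_on k S (\<lambda>x. frechet_derivative f (at x) b))"

definition smooth_on :: "'a::euclidean_space set \<Rightarrow> ('a \<Rightarrow> 'b::real_normed_vector) \<Rightarrow> bool" where
  "smooth_on S f \<longleftrightarrow> (\<forall>k. C_k_on k S f)"


section \<open>Hermitian matrices and the unit tangent bundle of hyperbolic space\<close>

type_synonym cmat2 = "complex^2^2"

definition adj :: "cmat2 \<Rightarrow> cmat2" where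
  "adj A = (\<chi> i j. cnj (A $ j $ i))"

definition Her2 :: "cmat2 set" where
  "Her2 = {A. adj A = A}"

text \<open>Polarisation of \<open>\<langle>\<xi>, \<xi>\<rangle> = - det \<xi>\<close>; determinants of Hermitian matrices are real.\<close>

definition lorentz :: "cmat2 \<Rightarrow> cmat2 \<Rightarrow> real" where
  "lorentz A B = - Re (det (A + B) - det A - det B) / 2"

definition H3 :: "cmat2 set" where
  "H3 = {x \<in> Her2. det x = 1 \<and> Re (trace x) > 0}"

definition UH3 :: "(cmat2 \<times> cmat2) set" where
  "UH3 = {(x, v). x \<in> H3 \<and> v \<in> Her2 \<and> lorentz v v = 1 \<and> lorentz x v = 0}"

definition e0 :: cmat2 where "e0 = mat 1"

definition e1 :: cmat2 where "e1 = vector [vector [1, 0], vector [0, -1]]"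

definition SL2 :: "cmat2 set" where "SL2 = {g. det g = 1}"

definition act :: "cmat2 \<Rightarrow> cmat2 \<times> cmat2 \<Rightarrow> cmat2 \<times> cmat2" where
  "act g = (\<lambda>(x, v). (g ** x ** adj g, g ** v ** adj g))"


section \<open>The reductive decomposition of the Lie algebra\<close>

definition cscale :: "complex \<Rightarrow> cmat2 \<Rightarrow> cmat2" where
  "cscale c A = (\<chi> i j. c * A $ i $ j)"

definition sl2 :: "cmat2 set" where "sl2 = {A. trace A = 0}"

definition sl2_inner :: "cmat2 \<Rightarrow> cmat2 \<Rightarrow> real" where
  "sl2_inner X Y = Re (trace (X ** Y)) / 2"

definition lie_h :: "cmat2 set" where
  "lie_h = {t *\<^sub>R cscale \<i> e1 | t. True}"

definition lie_p :: "cmat2 set" where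
  "lie_p = {X \<in> sl2. \<forall>Y\<in>lie_h. sl2_inner Y X = 0}"

text \<open>Orthogonal projection to \<open>lie_h\<close> and to its complement; note that
  \<open>sl2_inner (cscale \<i> e1) (cscale \<i> e1) = -1\<close>.\<close>

definition proj_h :: "cmat2 \<Rightarrow> cmat2" where
  "proj_h X = (sl2_inner (cscale \<i> e1) X / sl2_inner (cscale \<i> e1) (cscale \<i> e1))
                *\<^sub>R cscale \<i> e1"

definition proj_p :: "cmat2 \<Rightarrow> cmat2" where
  "proj_p X = X - proj_h X"


section \<open>The invariant metric and harmonic maps\<close>

text \<open>The derivative at \<open>t = 0\<close> of the curve \<open>exp (t Z) \<cdot> (e0, e1)\<close>.\<close>

definition fund_vec :: "cmat2 \<Rightarrow> cmat2 \<times> cmat2" where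
  "fund_vec Z = (Z ** e0 + e0 ** adj Z, Z ** e1 + e1 ** adj Z)"

text \<open>The invariant semi-Riemannian metric, obtained by transporting \<open>sl2_inner\<close> on
  \<open>lie_p\<close> from the base point \<open>(e0, e1)\<close> to \<open>q\<close>. Each \<open>g\<close> acts linearly on the ambient space,
  so its differential on tangent vectors is again \<open>act g\<close>. Independence of the choice of \<open>g\<close>
  is \<open>UH3_metric_act\<close> below. Rescaling the metric by a constant does not affect harmonicity.\<close>

definition UH3_metric ::
    "cmat2 \<times> cmat2 \<Rightarrow> cmat2 \<times> cmat2 \<Rightarrow> cmat2 \<times> cmat2 \<Rightarrow> real" where
  "UH3_metric q W W' = (THE r. \<exists>g\<in>SL2. \<exists>Z\<in>lie_p. \<exists>Z'\<in>lie_p.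
      act g (e0, e1) = q \<and> act g (fund_vec Z) = W \<and> act g (fund_vec Z') = W' \<and>
      r = sl2_inner Z Z')"

text \<open>The form is indefinite, so the energy may have either sign. Only the conformal
  class of the metric on the domain matters; the Euclidean one is used.\<close>

definition energy :: "complex set \<Rightarrow> (complex \<Rightarrow> cmat2 \<times> cmat2) \<Rightarrow> real" where
  "energy K F = (1/2) * (LINT z:K|lborel.
      UH3_metric (F z) (frechet_derivative F (at z) 1) (frechet_derivative F (at z) 1) +
      UH3_metric (F z) (frechet_derivative F (at z) \<i>) (frechet_derivative F (at z) \<i>))"

definition compact_variation ::
    "complex set \<Rightarrow> (complex \<Rightarrow> cmat2 \<times> cmat2) \<Rightarrow> complex set \<Rightarrow>
     (real \<Rightarrow> complex \<Rightarrow> cmat2 \<times> cmat2) \<Rightarrow> bool" where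
  "compact_variation D F K G \<longleftrightarrow>
     compact K \<and> K \<subseteq> D \<and>
     (\<exists>\<epsilon>>0. smooth_on ({-\<epsilon><..<\<epsilon>} \<times> D) (\<lambda>(t, z). G t z) \<and>
        (\<forall>t\<in>{-\<epsilon><..<\<epsilon>}. (\<forall>z\<in>D. G t z \<in> UH3) \<and> (\<forall>z\<in>D - K. G t z = F z))) \<and>
     (\<forall>z\<in>D. G 0 z = F z)"

definition harmonic_on :: "complex set \<Rightarrow> (complex \<Rightarrow> cmat2 \<times> cmat2) \<Rightarrow> bool" where
  "harmonic_on D F \<longleftrightarrow>
     smooth_on D F \<and> F ` D \<subseteq> UH3 \<and>
     (\<forall>K G. compact_variation D F K G \<longrightarrow>
        ((\<lambda>t. energy K (G t)) has_real_derivative 0) (at 0))"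

definition contact_form :: "cmat2 \<times> cmat2 \<Rightarrow> cmat2 \<times> cmat2 \<Rightarrow> real" where
  "contact_form = (\<lambda>(x, v) (X, V). lorentz X v)"

definition legendre_on :: "complex set \<Rightarrow> (complex \<Rightarrow> cmat2 \<times> cmat2) \<Rightarrow> bool" where
  "legendre_on D F \<longleftrightarrow>
     (\<forall>z\<in>D. \<forall>u. contact_form (F z) (frechet_derivative F (at z) u) = 0)"

definition frame_on ::
    "complex set \<Rightarrow> (complex \<Rightarrow> cmat2) \<Rightarrow> (complex \<Rightarrow> cmat2 \<times> cmat2) \<Rightarrow> bool" where
  "frame_on D \<Phi> F \<longleftrightarrow>
     smooth_on D \<Phi> \<and> (\<forall>z\<in>D. \<Phi> z \<in> SL2 \<and> F z = act (\<Phi> z) (e0, e1))"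


section \<open>Matrix-valued differential forms on planar domains\<close>

text \<open>Forms are functions of the base point followed by the (constant) tangent vectors.\<close>

type_synonym form1 = "complex \<Rightarrow> complex \<Rightarrow> cmat2"
type_synonym form2 = "complex \<Rightarrow> complex \<Rightarrow> complex \<Rightarrow> cmat2"

definition mc_form :: "(complex \<Rightarrow> cmat2) \<Rightarrow> form1" where
  "mc_form \<Phi> z u = matrix_inv (\<Phi> z) ** frechet_derivative \<Phi> (at z) u"

definition h_part :: "form1 \<Rightarrow> form1" where
  "h_part \<alpha> z u = proj_h (\<alpha> z u)"

definition p_part :: "form1 \<Rightarrow> form1" where
  "p_part \<alpha> z u = proj_p (\<alpha> z u)"

text \<open>For \<open>\<alpha> = A dz + B dw\<close>, where \<open>dw = cnj dz\<close>, one has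
  \<open>A = (\<alpha> 1 - \<i> \<alpha> \<i>) / 2\<close> and \<open>B = (\<alpha> 1 + \<i> \<alpha> \<i>) / 2\<close>.\<close>

definition part10 :: "form1 \<Rightarrow> form1" where
  "part10 \<alpha> z u = cscale u (cscale (1/2) (\<alpha> z 1 - cscale \<i> (\<alpha> z \<i>)))"

definition part01 :: "form1 \<Rightarrow> form1" where
  "part01 \<alpha> z u = cscale (cnj u) (cscale (1/2) (\<alpha> z 1 + cscale \<i> (\<alpha> z \<i>)))"

definition ext_deriv :: "form1 \<Rightarrow> form2" where
  "ext_deriv \<alpha> z u w =
     frechet_derivative (\<lambda>y. \<alpha> y w) (at z) u - frechet_derivative (\<lambda>y. \<alpha> y u) (at z) w"

definition bracket :: "cmat2 \<Rightarrow> cmat2 \<Rightarrow> cmat2" where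
  "bracket A B = A ** B - B ** A"

definition wedge_bracket :: "form1 \<Rightarrow> form1 \<Rightarrow> form2" where
  "wedge_bracket \<alpha> \<beta> z u w = bracket (\<alpha> z u) (\<beta> z w) - bracket (\<alpha> z w) (\<beta> z u)"

definition loop_form :: "complex \<Rightarrow> form1 \<Rightarrow> form1" where
  "loop_form c \<alpha> z u =
     h_part \<alpha> z u + cscale (inverse c) (part10 (p_part \<alpha>) z u) + cscale c (part01 (p_part \<alpha>) z u)"


section \<open>Consistency of the definitions\<close>

lemmas cmat2_simps =
  vec_eq_iff forall_2 matrix_matrix_mult_def sum_2 adj_def cscale_def trace_def mat_def
  e0_def e1_def det_2

lemma lie_p_iff:
  "Z \<in> lie_p \<longleftrightarrow> trace Z = 0 \<and> Im (Z $ 1 $ 1) = 0 \<and> Im (Z $ 2 $ 2) = 0"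
proof -
  have "sl2_inner (t *\<^sub>R cscale \<i> e1) Z = t * (Im (Z $ 2 $ 2) - Im (Z $ 1 $ 1)) / 2" for t
    by (simp add: sl2_inner_def cmat2_simps algebra_simps)
  then have "(\<forall>Y\<in>lie_h. sl2_inner Y Z = 0) \<longleftrightarrow> Im (Z $ 2 $ 2) = Im (Z $ 1 $ 1)"
    by (force simp: lie_h_def intro: exI[where x = 1])
  moreover have "trace Z = 0 \<Longrightarrow> Im (Z $ 1 $ 1) + Im (Z $ 2 $ 2) = 0"
    by (simp add: trace_def sum_2 complex_eq_iff)
  ultimately show ?thesis
    by (auto simp: lie_p_def sl2_def)
qed

lemma proj_h_mem: "proj_h X \<in> lie_h"
  unfolding proj_h_def lie_h_def by blast

lemma proj_p_mem: "X \<in> sl2 \<Longrightarrow> proj_p X \<in> lie_p"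
  by (auto simp: lie_p_iff proj_p_def proj_h_def sl2_def sl2_inner_def cmat2_simps
      complex_eq_iff field_simps)

lemma adj_mult: "adj (A ** B) = adj B ** adj A"
  by (simp add: cmat2_simps algebra_simps)

lemma act_mult: "act A (act B q) = act (A ** B) q"
  by (cases q) (simp add: act_def adj_mult matrix_mul_assoc)

lemma act_one: "act (mat 1) q = q"
  by (cases q) (simp add: act_def cmat2_simps)

lemma SL2_inv:
  assumes "g \<in> SL2"
  obtains k where "k \<in> SL2" "k ** g = mat 1" "g ** k = mat 1"
proof
  let ?k = "vector [vector [g $ 2 $ 2, - g $ 1 $ 2], vector [- g $ 2 $ 1, g $ 1 $ 1]] :: cmat2"
  show "?k \<in> SL2" "?k ** g = mat 1" "g ** ?k = mat 1"
    using assms by (auto simp: SL2_def cmat2_simps algebra_simps)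
qed

lemma isotropy:
  assumes "u \<in> SL2" "act u (e0, e1) = (e0, e1)"
  shows "u $ 1 $ 2 = 0" "u $ 2 $ 1 = 0" "u $ 2 $ 2 = cnj (u $ 1 $ 1)"
    "u $ 1 $ 1 * cnj (u $ 1 $ 1) = 1"
proof -
  have 1: "u $ 1 $ 1 * cnj (u $ 1 $ 1) + u $ 1 $ 2 * cnj (u $ 1 $ 2) = 1"
    "u $ 1 $ 1 * cnj (u $ 1 $ 1) - u $ 1 $ 2 * cnj (u $ 1 $ 2) = 1"
    "u $ 2 $ 1 * cnj (u $ 2 $ 1) + u $ 2 $ 2 * cnj (u $ 2 $ 2) = 1"
    "u $ 2 $ 1 * cnj (u $ 2 $ 1) - u $ 2 $ 2 * cnj (u $ 2 $ 2) = -1"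
    and d: "u $ 1 $ 1 * u $ 2 $ 2 - u $ 1 $ 2 * u $ 2 $ 1 = 1"
    using assms by (simp_all add: act_def SL2_def cmat2_simps)
  have "u $ 1 $ 2 * cnj (u $ 1 $ 2) = 0" "u $ 2 $ 1 * cnj (u $ 2 $ 1) = 0"
    using 1 by algebra+
  then show 12: "u $ 1 $ 2 = 0" and 21: "u $ 2 $ 1 = 0"
    by simp_all
  show 11: "u $ 1 $ 1 * cnj (u $ 1 $ 1) = 1"
    using 1 12 by simp
  show "u $ 2 $ 2 = cnj (u $ 1 $ 1)"
    using d 12 11 by algebra
qed

lemma isotropy_fund_vec:
  assumes u: "u \<in> SL2" "act u (e0, e1) = (e0, e1)"
    and p: "Y \<in> lie_p" "Z \<in> lie_p" and eq: "act u (fund_vec Y) = fund_vec Z"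
  shows "Z $ 1 $ 1 = Y $ 1 $ 1" "Z $ 2 $ 2 = Y $ 2 $ 2"
    "Z $ 1 $ 2 = u $ 1 $ 1 * u $ 1 $ 1 * Y $ 1 $ 2"
    "Z $ 2 $ 1 = cnj (u $ 1 $ 1) * cnj (u $ 1 $ 1) * Y $ 2 $ 1"
proof -
  note iso = isotropy[OF u]
  let ?s = "u $ 1 $ 1"
  have c: "cnj (Y $ 1 $ 1) = Y $ 1 $ 1" "cnj (Y $ 2 $ 2) = Y $ 2 $ 2"
    "cnj (Z $ 1 $ 1) = Z $ 1 $ 1" "cnj (Z $ 2 $ 2) = Z $ 2 $ 2"
    using p by (simp_all add: lie_p_iff complex_eq_iff)
  have E: "?s * (Y $ 1 $ 1 + Y $ 1 $ 1) * cnj ?s = Z $ 1 $ 1 + Z $ 1 $ 1"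
    "cnj ?s * (Y $ 2 $ 2 + Y $ 2 $ 2) * ?s = Z $ 2 $ 2 + Z $ 2 $ 2"
    "?s * (Y $ 1 $ 2 + cnj (Y $ 2 $ 1)) * ?s = Z $ 1 $ 2 + cnj (Z $ 2 $ 1)"
    "?s * (cnj (Y $ 2 $ 1) - Y $ 1 $ 2) * ?s = cnj (Z $ 2 $ 1) - Z $ 1 $ 2"
    "cnj ?s * (Y $ 2 $ 1 + cnj (Y $ 1 $ 2)) * cnj ?s = Z $ 2 $ 1 + cnj (Z $ 1 $ 2)"
    "cnj ?s * (Y $ 2 $ 1 - cnj (Y $ 1 $ 2)) * cnj ?s = Z $ 2 $ 1 - cnj (Z $ 1 $ 2)"
    using eq by (simp_all add: act_def fund_vec_def cmat2_simps iso c)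
  show "Z $ 1 $ 1 = Y $ 1 $ 1" "Z $ 2 $ 2 = Y $ 2 $ 2"
    using E(1,2) iso(4) by algebra+
  show "Z $ 1 $ 2 = ?s * ?s * Y $ 1 $ 2" using E(3,4) by algebra
  show "Z $ 2 $ 1 = cnj ?s * cnj ?s * Y $ 2 $ 1" using E(5,6) by algebra
qed

lemma UH3_metric_act:
  assumes g: "g \<in> SL2" and Z: "Z \<in> lie_p" "Z' \<in> lie_p"
  shows "UH3_metric (act g (e0, e1)) (act g (fund_vec Z)) (act g (fund_vec Z')) = sl2_inner Z Z'"
  unfolding UH3_metric_def
proof (rule the_equality)
  fix r
  assume "\<exists>h\<in>SL2. \<exists>Y\<in>lie_p. \<exists>Y'\<in>lie_p. act h (e0, e1) = act g (e0, e1) \<and>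
      act h (fund_vec Y) = act g (fund_vec Z) \<and> act h (fund_vec Y') = act g (fund_vec Z') \<and>
      r = sl2_inner Y Y'"
  then obtain h Y Y' where h: "h \<in> SL2" and Y: "Y \<in> lie_p" "Y' \<in> lie_p"
    and eq: "act h (e0, e1) = act g (e0, e1)" "act h (fund_vec Y) = act g (fund_vec Z)"
      "act h (fund_vec Y') = act g (fund_vec Z')" and r: "r = sl2_inner Y Y'"
    by blast
  obtain k where k: "k \<in> SL2" "k ** g = mat 1" using SL2_inv[OF g] by blast
  define u where "u = k ** h"
  have u: "u \<in> SL2" using k h by (simp add: u_def SL2_def det_mul)
  have *: "act u a = b" if "act h a = act g b" for a b
    by (metis that act_mult act_one k(2) u_def)
  note Zs = isotropy_fund_vec[OF u *[OF eq(1)] Y(1) Z(1) *[OF eq(2)]]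
    and Zs' = isotropy_fund_vec[OF u *[OF eq(1)] Y(2) Z(2) *[OF eq(3)]]
  have s: "u $ 1 $ 1 * cnj (u $ 1 $ 1) = 1" by (rule isotropy[OF u *[OF eq(1)]])
  have "trace (Z ** Z') = trace (Y ** Y')"
    unfolding cmat2_simps vec_lambda_beta Zs Zs' using s by algebra
  then show "r = sl2_inner Z Z'" by (simp add: r sl2_inner_def)
qed (use g Z in blast)

end

theory Submission
  imports Defs
begin

text \<open>
  Write \<open>\<alpha> = \<alpha>\<^sub>h + \<alpha>\<^sub>p\<close>. The homogeneous space is reductive but not symmetric: the bracket of two
  elements of \<open>lie_p\<close> usually has components in both summands, so in general the loop of forms
  attached to a harmonic map is not flat. The Legendre condition repairs this. The contact form
  evaluated on \<open>dF\<close> is twice the real part of the upper left entry of \<open>\<alpha>\<close>, so for a Legendre map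
  \<open>\<alpha>\<^sub>h\<close> is the diagonal and \<open>\<alpha>\<^sub>p\<close> the off-diagonal part of \<open>\<alpha>\<close> (lemma \<open>legendre_\<alpha>\<close>). Brackets of
  diagonal and off-diagonal matrices respect this grading, and the Maurer-Cartan equation
  (\<open>maurer_cartan\<close>) splits into \<open>d\<alpha>\<^sub>h + [\<alpha>\<^sub>h \<and> \<alpha>\<^sub>h] / 2 + [\<alpha>\<^sub>p' \<and> \<alpha>\<^sub>p''] = 0\<close> and
  \<open>d\<alpha>\<^sub>p + [\<alpha>\<^sub>h \<and> \<alpha>\<^sub>p] = 0\<close>.
  Together with the harmonic map equation \<open>d(*\<alpha>\<^sub>p) + [\<alpha>\<^sub>h \<and> *\<alpha>\<^sub>p] = 0\<close>, the latter says that the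
  coefficients of \<open>1/c\<close> and \<open>c\<close> in the curvature of the loop vanish separately; the former says
  the same of the constant coefficient (\<open>loop_form_flat\<close>).

  Harmonicity is defined by the vanishing of the first variation of the energy, so the
  harmonic map equation has to be derived. The test variations multiply the frame
  by \<open>mat 1 + t \<phi> X\<close>, where \<open>X\<close> is off-diagonal and nilpotent and \<open>\<phi>\<close> is a smooth bump function.
  They stay in \<open>SL2\<close> and the energy is a quadratic polynomial in \<open>t\<close>, so its linear
  coefficient is zero (\<open>first_variation\<close>). Integration by parts and the fundamental lemma of the
  calculus of variations then give the off-diagonal part of the harmonic map equation
  (\<open>euler_lagrange\<close>), which is all that is left of it for a Legendre map.

  The analysis behind this is developed first: closure properties of \<open>C_k_on\<close>, bump
  functions, integration by parts against functions of compact support, and, as a by-product of these,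
  the symmetry of second derivatives that the Maurer-Cartan equation rests on.
\<close>

section \<open>Calculus of \<open>C\<^sup>k\<close> maps\<close>

lemma C_k_on_cong:
  assumes "open S" "\<And>x. x \<in> S \<Longrightarrow> f x = g x" "C_k_on k S f"
  shows "C_k_on k S g"
  using assms(2,3)
proof (induction k arbitrary: f g)
  case 0
  then show ?case using continuous_on_cong by force
next
  case (Suc k)
  have d: "g differentiable at x" "frechet_derivative g (at x) = frechet_derivative f (at x)"
    if "x \<in> S" for x
  proof -
    have "(f has_derivative frechet_derivative f (at x)) (at x)"
      using Suc.prems(2) that frechet_derivative_works by auto
    then have "(g has_derivative frechet_derivative f (at x)) (at x)"
      using has_derivative_transform_within_open[OF _ assms(1) that] Suc.prems(1) by blast
    then show "g differentiable at x" "frechet_derivative g (at x) = frechet_derivative f (at x)"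
      using frechet_derivative_at differentiable_def by metis+
  qed
  have "C_k_on k S (\<lambda>x. frechet_derivative g (at x) b)" if "b \<in> Basis" for b
    by (rule Suc.IH[of "\<lambda>x. frechet_derivative f (at x) b"]) (use Suc.prems(2) that d in auto)
  then show ?case using d by simp
qed

text \<open>Rewriting the partial derivatives of \<open>f\<close> needs an equality on a neighbourhood; this rule
  hides that step, so that each closure property below only has to exhibit a formula for the
  derivative.\<close>

lemma C_k_on_SucI:
  assumes "open S" "\<And>x. x \<in> S \<Longrightarrow> (f has_derivative f' x) (at x)"
    and "\<And>b. b \<in> Basis \<Longrightarrow> C_k_on k S (\<lambda>x. f' x b)"
  shows "C_k_on (Suc k) S f"
  unfolding C_k_on.simps
proof (intro conjI ballI)
  show "f differentiable at x" if "x \<in> S" for x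
    using assms(2)[OF that] differentiable_def by blast
  show "C_k_on k S (\<lambda>x. frechet_derivative f (at x) b)" if "b \<in> Basis" for b
    by (rule C_k_on_cong[OF assms(1) _ assms(3)[OF that]])
      (use assms(2) frechet_derivative_at in metis)
qed

lemma C_k_on_Suc_has_derivative:
  "C_k_on (Suc k) S f \<Longrightarrow> x \<in> S \<Longrightarrow> (f has_derivative frechet_derivative f (at x)) (at x)"
  using frechet_derivative_works by auto

lemma C_k_on_SucD: "C_k_on (Suc k) S f \<Longrightarrow> C_k_on k S f"
proof (induction k arbitrary: f)
  case 0
  then show ?case
    by (auto intro!: continuous_at_imp_continuous_on differentiable_imp_continuous_within)
qed auto

lemma C_k_on_continuous: "C_k_on k S f \<Longrightarrow> continuous_on S f"
  by (induction k) (use C_k_on_SucD in auto)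

lemma C_k_on_subset: "C_k_on k S f \<Longrightarrow> T \<subseteq> S \<Longrightarrow> C_k_on k T f"
  by (induction k arbitrary: f) (auto intro: continuous_on_subset)

lemma C_k_on_const: "open S \<Longrightarrow> C_k_on k S (\<lambda>x. c)"
proof (induction k arbitrary: c)
  case (Suc k)
  show ?case
    by (rule C_k_on_SucI[where f' = "\<lambda>x h. 0"]) (use Suc in auto)
qed simp

lemma C_k_on_bounded_linear:
  assumes "bounded_linear h" "open S" "C_k_on k S f"
  shows "C_k_on k S (\<lambda>x. h (f x))"
  using assms(3)
proof (induction k arbitrary: f)
  case 0
  then show ?case
    using assms(1) by (auto intro: continuous_on_compose2[OF linear_continuous_on[OF assms(1)]])
next
  case (Suc k)
  show ?case
    by (rule C_k_on_SucI[where f' = "\<lambda>x b. h (frechet_derivative f (at x) b)"])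
      (use Suc assms C_k_on_Suc_has_derivative[OF Suc.prems]
       in \<open>auto intro!: bounded_linear.has_derivative[OF assms(1)]\<close>)
qed

lemma C_k_on_add:
  assumes "open S" "C_k_on k S f" "C_k_on k S g"
  shows "C_k_on k S (\<lambda>x. f x + g x)"
  using assms(2,3)
proof (induction k arbitrary: f g)
  case 0
  then show ?case by (auto intro: continuous_intros)
next
  case (Suc k)
  show ?case
    by (rule C_k_on_SucI[where f' = "\<lambda>x b. frechet_derivative f (at x) b + frechet_derivative g (at x) b"])
      (use Suc assms C_k_on_Suc_has_derivative[OF Suc.prems(1)] C_k_on_Suc_has_derivative[OF Suc.prems(2)]
       in \<open>auto intro!: has_derivative_add\<close>)
qed

lemma C_k_on_bilinear:
  assumes h: "bounded_bilinear h" and S: "open S" and "C_k_on k S f" "C_k_on k S g"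
  shows "C_k_on k S (\<lambda>x. h (f x) (g x))"
  using assms(3,4)
proof (induction k arbitrary: f g)
  case 0
  then show ?case using bounded_bilinear.continuous_on[OF h] by auto
next
  case (Suc k)
  show ?case
  proof (rule C_k_on_SucI[OF S, where f' = "\<lambda>x b. h (f x) (frechet_derivative g (at x) b)
                               + h (frechet_derivative f (at x) b) (g x)"])
    show "((\<lambda>x. h (f x) (g x)) has_derivative (\<lambda>b. h (f x) (frechet_derivative g (at x) b)
            + h (frechet_derivative f (at x) b) (g x))) (at x)" if "x \<in> S" for x
      by (intro bounded_bilinear.FDERIV[OF h] C_k_on_Suc_has_derivative[OF _ that])
        (use Suc.prems in auto)
    show "C_k_on k S (\<lambda>x. h (f x) (frechet_derivative g (at x) b)
            + h (frechet_derivative f (at x) b) (g x))" if "b \<in> Basis" for b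
      by (intro C_k_on_add[OF S] Suc.IH)
        (use Suc.prems that C_k_on_SucD[OF Suc.prems(1)] C_k_on_SucD[OF Suc.prems(2)] in auto)
  qed
qed

lemma C_k_on_linear:
  assumes "bounded_linear h" "open S"
  shows "C_k_on k S h"
proof (cases k)
  case 0
  then show ?thesis using assms linear_continuous_on by auto
next
  case (Suc j)
  show ?thesis unfolding Suc
    by (rule C_k_on_SucI[where f' = "\<lambda>x. h"])
      (use assms in \<open>auto intro: C_k_on_const bounded_linear_imp_has_derivative\<close>)
qed

text \<open>A family of maps that depends on a parameter is smooth in both variables jointly as soon as it is
  assembled from functions of one of the two. Basis vectors of the product point in one of the two
  factors; those of the first factor contribute the derivative \<open>0\<close>.\<close>

lemma C_k_on_snd:
  fixes f :: "'a::euclidean_space \<Rightarrow> 'b::real_normed_vector" and T :: "'c::euclidean_space set"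
  assumes "open S" "open T" "C_k_on k S f"
  shows "C_k_on k (T \<times> S) (\<lambda>p. f (snd p))"
  using assms(3)
proof (induction k arbitrary: f)
  case 0
  then show ?case by (auto intro!: continuous_on_compose2[of S f _ snd] continuous_intros)
next
  case (Suc k)
  show ?case
  proof (rule C_k_on_SucI[where f' = "\<lambda>p b. frechet_derivative f (at (snd p)) (snd b)"])
    show "((\<lambda>p. f (snd p)) has_derivative
        (\<lambda>b. frechet_derivative f (at (snd p)) (snd b))) (at p)" if "p \<in> T \<times> S" for p
      using that
      by (auto intro!: has_derivative_compose[OF has_derivative_snd[OF has_derivative_ident]]
          C_k_on_Suc_has_derivative[OF Suc.prems])
    fix b :: "'c \<times> 'a" assume "b \<in> Basis"
    then consider "snd b = 0" | "snd b \<in> Basis" by (auto simp: Basis_prod_def)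
    then show "C_k_on k (T \<times> S) (\<lambda>p. frechet_derivative f (at (snd p)) (snd b))"
    proof cases
      case 1
      have "C_k_on k (T \<times> S) (\<lambda>p. 0 :: 'b)" by (intro C_k_on_const open_Times assms)
      then show ?thesis
        by (rule C_k_on_cong[rotated 2])
          (use 1 assms linear_0[OF has_derivative_linear[OF C_k_on_Suc_has_derivative[OF Suc.prems]]] in
            \<open>auto intro: open_Times\<close>)
    qed (use Suc.prems in \<open>auto intro!: Suc.IH[of "\<lambda>x. frechet_derivative f (at x) (snd b)"]\<close>)
  qed (use assms in \<open>auto intro: open_Times\<close>)
qed

section \<open>Bump functions\<close>

text \<open>The functions \<open>exp (-1/s) / s ^ n\<close>, extended by \<open>0\<close> to \<open>s \<le> 0\<close>. The whole family is
  considered because its linear span is closed under differentiation, which turns smoothness of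
  the classical flat function \<open>n = 0\<close> into an induction.\<close>

definition flat_exp :: "nat \<Rightarrow> real \<Rightarrow> real" where
  "flat_exp n s = (if 0 < s then (1 / s) ^ n / exp (1 / s) else 0)"

lemma flat_exp_tendsto_0: "(flat_exp n \<longlongrightarrow> 0) (at_right 0)"
proof -
  have "((\<lambda>s. inverse s ^ n / exp (inverse s)) \<longlongrightarrow> (0::real)) (at_right 0)"
    by (rule filterlim_compose[OF tendsto_power_div_exp_0 filterlim_inverse_at_top_right])
  then show ?thesis
    by (rule Lim_transform_eventually)
      (auto simp: eventually_at_filter flat_exp_def inverse_eq_divide)
qed

text \<open>At the origin the difference quotient of member \<open>n\<close> is member \<open>n + 1\<close>, which tends to \<open>0\<close>.\<close>

lemma flat_exp_has_derivative:
  "(flat_exp n has_real_derivative (flat_exp (n + 2) s - real n * flat_exp (n + 1) s)) (at s)"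
proof -
  consider "s < 0" | "s = 0" | "0 < s" by linarith
  then show ?thesis
  proof cases
    case 1
    have "((\<lambda>s. 0) has_real_derivative 0) (at s)" by simp
    then have "(flat_exp n has_real_derivative 0) (at s)"
      by (rule has_field_derivative_transform_within_open[of _ _ _ "{..<0}"])
        (use 1 in \<open>auto simp: flat_exp_def\<close>)
    then show ?thesis using 1 by (simp add: flat_exp_def)
  next
    case 2
    have "((\<lambda>y. (flat_exp n y - flat_exp n 0) / (y - 0)) \<longlongrightarrow> 0) (at_left 0)"
      by (rule tendsto_eventually) (auto simp: eventually_at_filter flat_exp_def)
    moreover have "((\<lambda>y. (flat_exp n y - flat_exp n 0) / (y - 0)) \<longlongrightarrow> 0) (at_right 0)"
      by (rule Lim_transform_eventually[OF flat_exp_tendsto_0[of "Suc n"]])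
        (auto simp: eventually_at_filter flat_exp_def)
    ultimately show ?thesis
      using 2 by (simp add: has_field_derivative_iff filterlim_split_at flat_exp_def)
  next
    case 3
    have "((\<lambda>s. (1 / s) ^ n / exp (1 / s)) has_real_derivative
        (flat_exp (n + 2) s - real n * flat_exp (n + 1) s)) (at s)"
    proof -
      have "real n * (1 / s) ^ (n - 1) * (1 / s)\<^sup>2 = real n * (1 / s) ^ (n + 1)"
        by (cases n) (simp_all add: power2_eq_square)
      then show ?thesis
        using 3 by (auto intro!: derivative_eq_intros
          simp: flat_exp_def field_simps power2_eq_square)
    qed
    then show ?thesis
      by (rule has_field_derivative_transform_within_open[of _ _ _ "{0<..}"])
        (use 3 in \<open>auto simp: flat_exp_def\<close>)
  qed
qed

lemma C_k_on_flat_exp: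
  assumes S: "open S" and q: "\<And>k. C_k_on k S q"
  shows "C_k_on k S (\<lambda>x. flat_exp n (q x))"
proof (induction k arbitrary: n)
  case 0
  have "isCont (flat_exp n) s" for s n
    by (rule DERIV_isCont[OF flat_exp_has_derivative])
  then have "continuous_on UNIV (flat_exp n)" for n by (simp add: continuous_at_imp_continuous_on)
  then show ?case
    using q[of 0] by (auto intro: continuous_on_compose2)
next
  case (Suc k)
  let ?d = "\<lambda>x b. (flat_exp (n + 2) (q x) + (- real n) * flat_exp (n + 1) (q x)) *
              frechet_derivative q (at x) b"
  show ?case
  proof (rule C_k_on_SucI[OF S, where f' = ?d])
    show "((\<lambda>x. flat_exp n (q x)) has_derivative ?d x) (at x)" if "x \<in> S" for x
      using has_derivative_compose[OF C_k_on_Suc_has_derivative[OF q that]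
        flat_exp_has_derivative[THEN has_field_derivative_imp_has_derivative]]
      by (simp add: algebra_simps)
    show "C_k_on k S (\<lambda>x. ?d x b)" if "b \<in> Basis" for b
      by (intro C_k_on_bilinear[OF bounded_bilinear_mult S] C_k_on_add[OF S] Suc
          C_k_on_const[OF S]) (use q[of "Suc k"] that in simp)
  qed
qed

text \<open>For \<open>r > 0\<close>, a smooth function that is positive on the open ball of radius \<open>r\<close> about \<open>a\<close>
  and zero elsewhere. The argument of \<open>flat_exp\<close> is \<open>r\<^sup>2 - (dist a x)\<^sup>2\<close>, written as a sum of products so that its
  smoothness follows from the closure properties.\<close>

definition bump :: "'a::euclidean_space \<Rightarrow> real \<Rightarrow> 'a \<Rightarrow> real" where
  "bump a r x = flat_exp 0 (r\<^sup>2 + (a - x) \<bullet> (x - a))"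

lemma bump_arg: "r\<^sup>2 + (a - x) \<bullet> (x - a) = r\<^sup>2 - (dist a x)\<^sup>2"
  by (simp add: dist_norm power2_norm_eq_inner inner_diff algebra_simps)

lemma bump_pos: "dist a x < r \<Longrightarrow> bump a r x > 0"
  unfolding bump_def bump_arg by (simp add: flat_exp_def power_strict_mono)

lemma bump_nonneg: "bump a r x \<ge> 0"
  by (simp add: bump_def flat_exp_def)

lemma bump_eq_0: "0 \<le> r \<Longrightarrow> x \<notin> cball a r \<Longrightarrow> bump a r x = 0"
  unfolding bump_def bump_arg by (simp add: flat_exp_def not_less power_mono)

lemma C_k_on_bump_arg: "C_k_on k UNIV (\<lambda>x. r\<^sup>2 + (a - x) \<bullet> (x - a))"
proof -
  have "C_k_on k UNIV (\<lambda>x. r\<^sup>2 + (a + - x) \<bullet> (x + - a))"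
    by (intro C_k_on_add C_k_on_bilinear[OF bounded_bilinear_inner] C_k_on_const C_k_on_linear
        bounded_linear_minus bounded_linear_ident open_UNIV)
  then show ?thesis by simp
qed

lemma C_k_on_bump: "C_k_on k UNIV (bump a r)"
  unfolding bump_def[abs_def] by (intro C_k_on_flat_exp C_k_on_bump_arg open_UNIV)

section \<open>Integration by parts and the fundamental lemma\<close>

lemma lborel_integral_translate:
  fixes f :: "'a::euclidean_space \<Rightarrow> real"
  assumes "f \<in> borel_measurable borel"
  shows "(LINT x|lborel. f (a + x)) = (LINT x|lborel. f x)"
proof -
  have "(LINT x|lborel. f x) = (LINT x|distr lborel borel ((+) a). f x)"
    by (simp add: lborel_distr_plus)
  also have "\<dots> = (LINT x|lborel. f (a + x))"
    by (rule integral_distr) (use assms in auto)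
  finally show ?thesis by simp
qed

lemma frechet_derivative_eq_0:
  fixes f :: "'a::real_normed_vector \<Rightarrow> 'b::real_normed_vector"
  assumes "closed K" "\<And>x. x \<notin> K \<Longrightarrow> f x = 0" "x \<notin> K"
  shows "frechet_derivative f (at x) = (\<lambda>h. 0)"
proof -
  have "(f has_derivative (\<lambda>h. 0)) (at x)"
    by (rule has_derivative_transform_within_open[OF has_derivative_const[of 0], of "- K"])
      (use assms in auto)
  then show ?thesis using frechet_derivative_at by metis
qed

text \<open>By translation invariance of Lebesgue measure the difference quotients of \<open>f\<close> in the direction
  \<open>u\<close> have integral zero. They are dominated by a bound for the derivative on a ball, so the
  integral of their limit vanishes as well.\<close>

lemma integral_directional_derivative_eq_0:
  fixes f :: "'a::euclidean_space \<Rightarrow> real"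
  assumes f: "\<And>x. (f has_derivative f' x) (at x)" and cont: "continuous_on UNIV (\<lambda>x. f' x u)"
    and K: "compact K" "\<And>x. x \<notin> K \<Longrightarrow> f x = 0"
  shows "(LINT x|lborel. f' x u) = 0"
proof -
  have contf: "continuous_on UNIV f"
    by (intro continuous_at_imp_continuous_on ballI has_derivative_continuous[OF f])
  have meas: "f \<in> borel_measurable borel" "(\<lambda>x. f' x u) \<in> borel_measurable borel"
    by (intro borel_measurable_continuous_onI contf cont)+
  have f'0: "f' x u = 0" if "x \<notin> K" for x
    by (subst frechet_derivative_at[OF f])
      (simp add: frechet_derivative_eq_0[OF compact_imp_closed[OF K(1)] K(2) that])
  obtain B where B: "\<And>x. \<bar>f' x u\<bar> \<le> B" "B \<ge> 0"
  proof -
    have "bounded ((\<lambda>x. f' x u) ` K)"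
      by (intro compact_imp_bounded compact_continuous_image K continuous_on_subset[OF cont]) auto
    then obtain B where "\<And>x. x \<in> K \<Longrightarrow> \<bar>f' x u\<bar> \<le> B" by (auto simp: bounded_iff)
    then have "\<bar>f' x u\<bar> \<le> max B 0" for x using f'0[of x] by (cases "x \<in> K") fastforce+
    then show ?thesis using that[of "max B 0"] by auto
  qed
  obtain R where R: "K \<subseteq> cball 0 R"
    using compact_imp_bounded[OF K(1)] by (auto simp: bounded_iff subset_iff)
  have line: "((\<lambda>t. f (x + t *\<^sub>R u)) has_real_derivative f' (x + t *\<^sub>R u) u) (at t)" for x t
  proof -
    have "((\<lambda>t. f (x + t *\<^sub>R u)) has_derivative (\<lambda>h. f' (x + t *\<^sub>R u) (h *\<^sub>R u))) (at t)"
      by (rule has_derivative_compose[OF _ f]) (auto intro!: derivative_eq_intros)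
    then show ?thesis
      by (rule has_derivative_imp_has_field_derivative)
        (simp add: linear_cmul[OF has_derivative_linear[OF f]])
  qed
  define s where "s n x = real (Suc n) * (f (x + (1 / real (Suc n)) *\<^sub>R u) - f x)" for n x
  have int: "integrable lborel f"
  proof -
    have "integrable lborel (\<lambda>x. indicator K x *\<^sub>R f x)"
      by (intro borel_integrable_compact K continuous_on_subset[OF contf]) auto
    moreover have "(\<lambda>x. indicator K x *\<^sub>R f x) = f" using K(2) by (force simp: indicator_def)
    ultimately show ?thesis by simp
  qed
  have int_s: "(LINT x|lborel. s n x) = 0" for n
  proof -
    let ?a = "(1 / real (Suc n)) *\<^sub>R u"
    have "integrable lborel (\<lambda>x. f (?a + x))"
      using integrable_distr_eq[of "(+) ?a" lborel borel f] int meas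
      by (simp add: lborel_distr_plus)
    then have "(LINT x|lborel. f (?a + x) - f x) = 0"
      using int lborel_integral_translate[OF meas(1), of ?a] by simp
    then show ?thesis by (simp add: s_def[abs_def] add.commute)
  qed
  have lim: "(\<lambda>n. s n x) \<longlonglongrightarrow> f' x u" for x
  proof -
    have "((\<lambda>h. (f (x + h *\<^sub>R u) - f x) / h) \<longlongrightarrow> f' x u) (at 0)"
      using line[of x 0] by (simp add: DERIV_def)
    moreover have "filterlim (\<lambda>n. 1 / real (Suc n)) (at 0) sequentially"
      using LIMSEQ_Suc[OF lim_1_over_n[where 'a = real]] by (simp add: filterlim_at)
    ultimately show ?thesis
      by (auto dest: filterlim_compose simp: s_def mult.commute)
  qed
  have bound: "\<bar>s n x\<bar> \<le> B * indicator (cball 0 (R + norm u)) x" for n x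
  proof (cases "x \<in> cball 0 (R + norm u)")
    case True
    let ?e = "1 / real (Suc n)"
    obtain t where "f (x + ?e *\<^sub>R u) - f (x + 0 *\<^sub>R u) = (?e - 0) * f' (x + t *\<^sub>R u) u"
      using MVT2[of 0 ?e "\<lambda>t. f (x + t *\<^sub>R u)" "\<lambda>t. f' (x + t *\<^sub>R u) u"] line by auto
    then have "s n x = f' (x + t *\<^sub>R u) u" by (simp add: s_def)
    then show ?thesis using True B by simp
  next
    case False
    have "norm ((1 / real (Suc n)) *\<^sub>R u) \<le> norm u"
      by (simp add: divide_le_eq algebra_simps)
    then have "x \<notin> cball 0 R" "x + (1 / real (Suc n)) *\<^sub>R u \<notin> cball 0 R"
      using False norm_triangle_ineq4[of "x + (1 / real (Suc n)) *\<^sub>R u" "(1 / real (Suc n)) *\<^sub>R u"]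
        norm_ge_zero[of u]
      by (auto simp del: norm_ge_zero)
    then have "x \<notin> K" "x + (1 / real (Suc n)) *\<^sub>R u \<notin> K" using R by blast+
    then have "s n x = 0" by (simp add: s_def K(2))
    then show ?thesis using False by simp
  qed
  have "(\<lambda>n. LINT x|lborel. s n x) \<longlonglongrightarrow> (LINT x|lborel. f' x u)"
  proof (rule integral_dominated_convergence)
    show "integrable lborel (\<lambda>x::'a. B * indicator (cball 0 (R + norm u)) x)"
      using emeasure_bounded_finite[OF bounded_cball, of "0::'a" "R + norm u"]
      by (intro integrable_mult_right integrable_real_indicator) auto
    show "(\<lambda>x. f' x u) \<in> borel_measurable lborel" using meas by simp
    show "s n \<in> borel_measurable lborel" for n
      unfolding s_def[abs_def]
      by (simp, intro borel_measurable_continuous_onI continuous_intros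
          continuous_on_compose2[OF contf] subset_UNIV)
  qed (use lim bound in \<open>auto intro!: AE_I2\<close>)
  then show ?thesis using int_s by (simp add: LIMSEQ_const_iff)
qed

text \<open>The product \<open>\<phi> * P\<close> is differentiable on the whole space, because \<open>\<phi>\<close> vanishes off a compact
  subset of \<open>D\<close>; hence its directional derivative integrates to zero.\<close>

lemma integration_by_parts:
  fixes \<phi> P :: "'a::euclidean_space \<Rightarrow> real"
  assumes D: "open D" and K: "compact K" "K \<subseteq> D"
    and \<phi>: "C_k_on (Suc 0) UNIV \<phi>" "\<And>x. x \<notin> K \<Longrightarrow> \<phi> x = 0"
    and P: "C_k_on (Suc 0) D P" and u: "u \<in> Basis"
  shows "(LINT x:K|lborel. frechet_derivative \<phi> (at x) u * P x) =
         - (LINT x:K|lborel. \<phi> x * frechet_derivative P (at x) u)"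
proof -
  let ?d = "\<lambda>x v. \<phi> x * frechet_derivative P (at x) v + frechet_derivative \<phi> (at x) v * P x"
  let ?f' = "\<lambda>x v. if x \<in> D then ?d x v else 0"
  have opn: "open (- K)" using K compact_imp_closed by auto
  have \<phi>0: "frechet_derivative \<phi> (at x) = (\<lambda>h. 0)" if "x \<notin> K" for x
    by (rule frechet_derivative_eq_0[OF compact_imp_closed[OF K(1)] \<phi>(2) that])
  have der: "((\<lambda>x. \<phi> x * P x) has_derivative ?f' x) (at x)" for x
  proof (cases "x \<in> D")
    case True
    show ?thesis
      using True has_derivative_mult[OF C_k_on_Suc_has_derivative[OF \<phi>(1)] C_k_on_Suc_has_derivative[OF P]]
      by simp
  next
    case False
    then have "x \<in> - K" using K by auto
    show ?thesis
      by (rule has_derivative_transform_within_open[OF _ opn \<open>x \<in> - K\<close>, of "\<lambda>x. 0"])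
        (use False \<phi>(2) in auto)
  qed
  have contD: "continuous_on D (\<lambda>x. \<phi> x * frechet_derivative P (at x) u)"
      "continuous_on D (\<lambda>x. frechet_derivative \<phi> (at x) u * P x)"
    using P \<phi>(1) u C_k_on_continuous[OF P] C_k_on_continuous[OF \<phi>(1)]
    by (auto intro!: continuous_intros intro: continuous_on_subset)
  have "continuous_on D (\<lambda>x. ?f' x u)"
    using continuous_on_add[OF contD] by (simp cong: continuous_on_cong)
  moreover have "continuous_on (- K) (\<lambda>x. ?f' x u)"
  proof (rule continuous_on_eq[of _ "\<lambda>x. 0"])
    show "0 = ?f' x u" if "x \<in> - K" for x using that \<phi>(2) \<phi>0 by simp
  qed simp
  ultimately have "continuous_on (D \<union> - K) (\<lambda>x. ?f' x u)"
    using continuous_on_open_Un[OF D opn] by blast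
  moreover have "D \<union> - K = UNIV" using K by auto
  ultimately have "(LINT x|lborel. ?f' x u) = 0"
    using integral_directional_derivative_eq_0[OF der, of u K] K \<phi>(2) by auto
  moreover have "?f' x u = indicator K x *\<^sub>R ?d x u" for x
    using K \<phi>(2) \<phi>0 by (auto simp: indicator_def)
  ultimately have "(LINT x:K|lborel. ?d x u) = 0" by (simp add: set_lebesgue_integral_def)
  moreover have "set_integrable lborel K (\<lambda>x. \<phi> x * frechet_derivative P (at x) u)"
      "set_integrable lborel K (\<lambda>x. frechet_derivative \<phi> (at x) u * P x)"
    unfolding set_integrable_def
    using borel_integrable_compact[OF K(1)] continuous_on_subset[OF _ K(2)] contD by blast+
  ultimately show ?thesis by (simp add: set_integral_add)
qed

lemma set_integral_pos:
  fixes f :: "'a::euclidean_space \<Rightarrow> real"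
  assumes K: "compact K" and f: "continuous_on K f" "\<And>x. x \<in> K \<Longrightarrow> f x \<ge> 0"
    and a: "a \<in> interior K" "f a > 0"
  shows "(LINT x:K|lborel. f x) > 0"
proof -
  have "continuous (at a) f" by (rule continuous_on_interior[OF f(1) a(1)])
  then have "eventually (\<lambda>x. f x > f a / 2) (at a)"
    unfolding continuous_at by (rule order_tendstoD) (use a(2) in simp)
  then obtain d where d: "d > 0" "\<And>x. x \<noteq> a \<Longrightarrow> dist x a < d \<Longrightarrow> f x > f a / 2"
    by (auto simp: eventually_at)
  obtain e where e: "e > 0" "ball a e \<subseteq> K" using a by (auto simp: mem_interior)
  let ?B = "ball a (min d e)"
  have "?B \<subseteq> K" using e by auto
  have low: "f a / 2 \<le> f x" if "x \<in> ?B" for x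
    using that d(2)[of x] a(2) by (cases "x = a") (auto simp: dist_commute)
  have fin: "emeasure lborel ?B < \<infinity>" by (rule emeasure_bounded_finite) simp
  have "0 < f a / 2 * measure lborel ?B"
    using a(2) d(1) e(1) by (simp add: content_ball_pos)
  also have "\<dots> = (LINT x|lborel. f a / 2 * indicator ?B x)" by simp
  also have "\<dots> \<le> (LINT x|lborel. indicator K x *\<^sub>R f x)"
  proof (rule integral_mono)
    show "integrable lborel (\<lambda>x. f a / 2 * indicator ?B x)"
      using fin by (intro integrable_mult_right integrable_real_indicator) auto
    show "f a / 2 * indicator ?B x \<le> indicator K x *\<^sub>R f x" for x
      using low[of x] f(2)[of x] \<open>?B \<subseteq> K\<close> by (auto simp: indicator_def)
  qed (rule borel_integrable_compact[OF K f(1)])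
  finally show ?thesis by (simp add: set_lebesgue_integral_def)
qed

text \<open>The fundamental lemma of the calculus of variations. If \<open>g z\<close> were nonzero, \<open>g\<close> would have a
  constant sign on a small ball about \<open>z\<close>, and its integral against the bump function of that ball
  would be nonzero too.\<close>

lemma fundamental_lemma_bump:
  fixes g :: "'a::euclidean_space \<Rightarrow> real"
  assumes D: "open D" and g: "continuous_on D g"
    and ortho: "\<And>a r. 0 < r \<Longrightarrow> cball a r \<subseteq> D \<Longrightarrow> (LINT x:cball a r|lborel. bump a r x * g x) = 0"
    and z: "z \<in> D"
  shows "g z = 0"
proof (rule ccontr)
  assume "g z \<noteq> 0"
  define \<sigma> where "\<sigma> = sgn (g z)"
  have pos: "\<sigma> * g z > 0" using \<open>g z \<noteq> 0\<close> by (simp add: \<sigma>_def sgn_if)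
  have c: "continuous_on D (\<lambda>x. \<sigma> * g x)" using g by (intro continuous_intros)
  have "open {x \<in> D. \<sigma> * g x > 0}"
    using continuous_open_preimage[OF c D, of "{0<..}"] by (simp add: vimage_def Int_def)
  then obtain r where r: "r > 0" "cball z r \<subseteq> {x \<in> D. \<sigma> * g x > 0}"
    using pos z by (auto simp: open_contains_cball)
  have "(LINT x:cball z r|lborel. bump z r x * (\<sigma> * g x)) > 0"
  proof (rule set_integral_pos[where a = z])
    show "continuous_on (cball z r) (\<lambda>x. bump z r x * (\<sigma> * g x))"
      using r(2) by (intro continuous_on_mult continuous_on_subset[OF c]
          continuous_on_subset[OF C_k_on_continuous[OF C_k_on_bump[of 0]]]) auto
    show "0 \<le> bump z r x * (\<sigma> * g x)" if "x \<in> cball z r" for x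
      using r(2) that bump_nonneg[of z r x]
      by (intro mult_nonneg_nonneg[of "bump z r x" "\<sigma> * g x"]) auto
  qed (use r(1) pos bump_pos[of z z r] in auto)
  also have "(LINT x:cball z r|lborel. bump z r x * (\<sigma> * g x)) = \<sigma> * (LINT x:cball z r|lborel. bump z r x * g x)"
    by (simp add: mult.left_commute)
  also have "\<dots> = 0" using ortho[OF r(1)] r(2) by (simp add: subset_iff)
  finally show False by simp
qed

section \<open>Symmetry of second derivatives\<close>

lemma bump_has_derivative:
  "(bump a r has_derivative (\<lambda>u. flat_exp 2 (r\<^sup>2 + (a - x) \<bullet> (x - a)) * (2 * ((a - x) \<bullet> u)))) (at x)"
proof -
  have "((\<lambda>x. r\<^sup>2 + (a - x) \<bullet> (x - a)) has_derivative (\<lambda>u. 2 * ((a - x) \<bullet> u))) (at x)"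
    by (auto intro!: derivative_eq_intros simp: fun_eq_iff inner_diff inner_commute)
  from has_derivative_compose[OF this flat_exp_has_derivative[of 0, THEN has_field_derivative_imp_has_derivative]]
  show ?thesis by (simp add: bump_def[abs_def] eval_nat_numeral)
qed

text \<open>The second derivatives of the bump functions are explicit, and visibly symmetric.\<close>

lemma bump_second_derivative:
  "frechet_derivative (\<lambda>x. frechet_derivative (bump a r) (at x) u) (at x) v =
   frechet_derivative (\<lambda>x. frechet_derivative (bump a r) (at x) v) (at x) u"
proof -
  let ?q = "\<lambda>x. r\<^sup>2 + (a - x) \<bullet> (x - a)"
  have d: "frechet_derivative (bump a r) (at x) = (\<lambda>u. flat_exp 2 (?q x) * (2 * ((a - x) \<bullet> u)))" for x
    using bump_has_derivative frechet_derivative_at by metis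
  have q: "(?q has_derivative (\<lambda>u. 2 * ((a - x) \<bullet> u))) (at x)"
    by (auto intro!: derivative_eq_intros simp: fun_eq_iff inner_diff inner_commute)
  obtain D where D: "(flat_exp 2 has_real_derivative D) (at (?q x))"
    using flat_exp_has_derivative by blast
  note f = has_derivative_compose[OF q D[THEN has_field_derivative_imp_has_derivative]]
  have l: "((\<lambda>x. 2 * ((a - x) \<bullet> u)) has_derivative (\<lambda>v. - 2 * (v \<bullet> u))) (at x)" for u
    by (auto intro!: derivative_eq_intros)
  have "frechet_derivative (\<lambda>x. flat_exp 2 (?q x) * (2 * ((a - x) \<bullet> u))) (at x) v =
      flat_exp 2 (?q x) * (- 2 * (v \<bullet> u)) + D * (2 * ((a - x) \<bullet> v)) * (2 * ((a - x) \<bullet> u))" for u v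
    using frechet_derivative_at[OF has_derivative_mult[OF f l[of u]]] by (metis (no_types, lifting))
  then show ?thesis by (simp add: d inner_commute mult_ac)
qed

text \<open>Symmetry of second derivatives, obtained from distribution theory: two integrations by parts
  move both derivatives from \<open>f\<close> to a bump function, where they commute, and the
  fundamental lemma returns to a pointwise statement.\<close>

lemma mixed_derivatives_commute_real:
  fixes f :: "'a::euclidean_space \<Rightarrow> real"
  assumes D: "open D" and f: "C_k_on 2 D f" and uv: "u \<in> Basis" "v \<in> Basis" and z: "z \<in> D"
  shows "frechet_derivative (\<lambda>x. frechet_derivative f (at x) v) (at z) u =
         frechet_derivative (\<lambda>x. frechet_derivative f (at x) u) (at z) v"
proof -
  let ?d = "\<lambda>u f x. frechet_derivative f (at x) u"
  have f1: "C_k_on (Suc 0) D (?d u f)" if "u \<in> Basis" for u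
    using f that by (simp add: numeral_2_eq_2)
  have f0: "C_k_on (Suc 0) D f" using f C_k_on_SucD by (simp only: numeral_2_eq_2)
  have cont: "continuous_on D (?d u (?d v f))" if "u \<in> Basis" "v \<in> Basis" for u v
    using f1[OF that(2)] that(1) by simp
  have b2: "C_k_on (Suc (Suc 0)) UNIV (bump a r)" for a :: 'a and r by (rule C_k_on_bump)
  have 1: "(LINT x:cball a r|lborel. bump a r x * ?d u (?d v f) x) =
      (LINT x:cball a r|lborel. ?d v (?d u (bump a r)) x * f x)"
    if r: "0 < r" "cball a r \<subseteq> D" and uv: "u \<in> Basis" "v \<in> Basis" for a r u v
  proof -
    let ?K = "cball a r"
    have b0: "bump a r x = 0" if "x \<notin> ?K" for x using r that bump_eq_0[of r x a] by simp
    have db0: "?d u (bump a r) x = 0" if "x \<notin> ?K" for x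
      using frechet_derivative_eq_0[OF closed_cball b0 that] by simp
    have "(LINT x:?K|lborel. ?d u (bump a r) x * ?d v f x) =
        - (LINT x:?K|lborel. bump a r x * ?d u (?d v f) x)"
      by (rule integration_by_parts[OF D _ r(2) C_k_on_bump b0 f1[OF uv(2)] uv(1)]) auto
    moreover have "(LINT x:?K|lborel. ?d v (?d u (bump a r)) x * f x) =
        - (LINT x:?K|lborel. ?d u (bump a r) x * ?d v f x)"
      by (rule integration_by_parts[OF D _ r(2) _ db0 f0 uv(2)]) (use b2[of a r] uv in auto)
    ultimately show ?thesis by simp
  qed
  have "?d u (?d v f) z - ?d v (?d u f) z = 0"
  proof (rule fundamental_lemma_bump[OF D _ _ z])
    show "continuous_on D (\<lambda>x. ?d u (?d v f) x - ?d v (?d u f) x)"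
      by (intro continuous_on_diff cont uv)
    fix a r assume r: "0 < (r::real)" "cball a r \<subseteq> D"
    have "set_integrable lborel (cball a r) (\<lambda>x. bump a r x * ?d u (?d v f) x)"
      if "u \<in> Basis" "v \<in> Basis" for u v
      unfolding set_integrable_def
      by (intro borel_integrable_compact compact_cball continuous_on_mult
          continuous_on_subset[OF cont[OF that] r(2)]
          continuous_on_subset[OF C_k_on_continuous[OF C_k_on_bump[of 0]] subset_UNIV])
    then have "(LINT x:cball a r|lborel. bump a r x * (?d u (?d v f) x - ?d v (?d u f) x)) =
        (LINT x:cball a r|lborel. bump a r x * ?d u (?d v f) x) -
        (LINT x:cball a r|lborel. bump a r x * ?d v (?d u f) x)"
      using uv by (simp add: right_diff_distrib set_integral_diff)
    also have "\<dots> = 0"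
      using 1[OF r uv] 1[OF r uv(2,1)] bump_second_derivative[of a r u _ v] by simp
    finally show "(LINT x:cball a r|lborel. bump a r x * (?d u (?d v f) x - ?d v (?d u f) x)) = 0" .
  qed
  then show ?thesis by simp
qed

lemma frechet_derivative_bounded_linear:
  assumes "bounded_linear h" "f differentiable at x"
  shows "frechet_derivative (\<lambda>x. h (f x)) (at x) u = h (frechet_derivative f (at x) u)"
  using frechet_derivative_at[OF bounded_linear.has_derivative[OF assms(1)]] assms(2)
    frechet_derivative_works by metis

lemma mixed_derivatives_commute:
  fixes f :: "'a::euclidean_space \<Rightarrow> 'b::euclidean_space"
  assumes D: "open D" and f: "C_k_on 2 D f" and uv: "u \<in> Basis" "v \<in> Basis" and z: "z \<in> D"
  shows "frechet_derivative (\<lambda>x. frechet_derivative f (at x) v) (at z) u =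
         frechet_derivative (\<lambda>x. frechet_derivative f (at x) u) (at z) v"
proof (rule euclidean_eqI)
  fix b :: 'b assume "b \<in> Basis"
  let ?d = "\<lambda>u f x. frechet_derivative f (at x) u"
  note bl = bounded_linear_inner_left[of b]
  have diff: "f differentiable at x" "?d u f differentiable at x"
    if "x \<in> D" "u \<in> Basis" for x u
    using f that by (auto simp: numeral_2_eq_2)
  have c: "?d u (?d v (\<lambda>x. f x \<bullet> b)) z = ?d u (?d v f) z \<bullet> b" if "u \<in> Basis" "v \<in> Basis" for u v
  proof -
    have "((\<lambda>x. ?d v f x \<bullet> b) has_derivative (\<lambda>u. ?d u (?d v f) z \<bullet> b)) (at z)"
      by (intro bounded_linear.has_derivative[OF bl]) (use diff(2)[OF z that(2)] frechet_derivative_works in blast)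
    then have "(?d v (\<lambda>x. f x \<bullet> b) has_derivative (\<lambda>u. ?d u (?d v f) z \<bullet> b)) (at z)"
      by (rule has_derivative_transform_within_open[OF _ D z])
        (simp add: diff(1)[OF _ that(1)] frechet_derivative_bounded_linear[OF bl])
    then show ?thesis using frechet_derivative_at by metis
  qed
  show "?d u (?d v f) z \<bullet> b = ?d v (?d u f) z \<bullet> b"
    using mixed_derivatives_commute_real[OF D C_k_on_bounded_linear[OF bl D f] uv z] c uv by simp
qed

section \<open>The action of \<open>SL2\<close> on the unit tangent bundle\<close>

lemma bounded_bilinear_cmat2_mult: "bounded_bilinear ((**) :: cmat2 \<Rightarrow> cmat2 \<Rightarrow> cmat2)"
  unfolding bilinear_conv_bounded_bilinear[symmetric] bilinear_def
  by (auto intro!: linearI simp: cmat2_simps algebra_simps)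

interpretation mmul: bounded_bilinear "(**) :: cmat2 \<Rightarrow> cmat2 \<Rightarrow> cmat2"
  by (rule bounded_bilinear_cmat2_mult)

lemma bounded_linear_adj: "bounded_linear adj"
  unfolding linear_conv_bounded_linear[symmetric]
  by (auto intro!: linearI simp: cmat2_simps)

lemma bounded_linear_entry: "bounded_linear (\<lambda>A :: cmat2. A $ i $ j)"
  by (rule bounded_linear_compose[OF bounded_linear_vec_nth bounded_linear_vec_nth])

text \<open>On \<open>SL2\<close> the inverse is the adjugate matrix, which is linear in the entries; this makes the
  inverse of a frame easy to differentiate.\<close>

definition cofactor :: "cmat2 \<Rightarrow> cmat2" where
  "cofactor g = vector [vector [g $ 2 $ 2, - g $ 1 $ 2], vector [- g $ 2 $ 1, g $ 1 $ 1]]"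

lemma bounded_linear_cofactor: "bounded_linear cofactor"
  unfolding linear_conv_bounded_linear[symmetric]
  by (auto intro!: linearI simp: cmat2_simps cofactor_def)

lemma cofactor_mult:
  assumes "g \<in> SL2" shows "cofactor g ** g = mat 1" "g ** cofactor g = mat 1"
  using assms by (auto simp: SL2_def cofactor_def cmat2_simps algebra_simps)

lemma matrix_inv_SL2:
  assumes "g \<in> SL2" shows "matrix_inv g = cofactor g"
proof -
  have "g ** matrix_inv g = mat 1"
    unfolding matrix_inv_def by (rule someI2[of _ "cofactor g"]) (simp_all add: cofactor_mult[OF assms])
  then have "cofactor g ** (g ** matrix_inv g) = cofactor g" by (simp add: matrix_mul_rid)
  then show ?thesis
    by (simp add: matrix_mul_assoc cofactor_mult[OF assms] matrix_mul_lid)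
qed

lemma C_k_on_act:
  fixes \<Psi> :: "'a::euclidean_space \<Rightarrow> cmat2"
  assumes "open S" "C_k_on k S \<Psi>"
  shows "C_k_on k S (\<lambda>x. act (\<Psi> x) (p, q))"
proof -
  have *: "C_k_on k S (\<lambda>x. \<Psi> x ** m ** adj (\<Psi> x))" for m
    by (intro C_k_on_bilinear[OF bounded_bilinear_cmat2_mult] C_k_on_const assms
        C_k_on_bounded_linear[OF bounded_linear_adj])
  have "C_k_on k S (\<lambda>x. (\<Psi> x ** p ** adj (\<Psi> x), 0) + (0, \<Psi> x ** q ** adj (\<Psi> x)))"
    by (rule C_k_on_add[OF assms(1)
          C_k_on_bounded_linear[OF bounded_linear_Pair[OF bounded_linear_ident bounded_linear_zero] assms(1) *]
          C_k_on_bounded_linear[OF bounded_linear_Pair[OF bounded_linear_zero bounded_linear_ident] assms(1) *]])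
  then show ?thesis by (simp add: act_def)
qed

text \<open>When \<open>\<beta>\<close> is the logarithmic derivative of \<open>\<Psi>\<close>, the differential of \<open>\<Psi> \<cdot> (e0, e1)\<close> is the
  fundamental vector field of \<open>\<beta>\<close> at the base point, transported by \<open>\<Psi>\<close>.\<close>

lemma has_derivative_act:
  fixes \<Psi> :: "'a::real_normed_vector \<Rightarrow> cmat2"
  assumes "(\<Psi> has_derivative (\<lambda>h. \<Psi> x ** \<beta> h)) (at x)"
  shows "((\<lambda>y. act (\<Psi> y) (e0, e1)) has_derivative (\<lambda>h. act (\<Psi> x) (fund_vec (\<beta> h)))) (at x)"
proof -
  have "((\<lambda>y. \<Psi> y ** m ** adj (\<Psi> y)) has_derivative
      (\<lambda>h. \<Psi> x ** m ** adj (\<Psi> x ** \<beta> h) + (\<Psi> x ** 0 + \<Psi> x ** \<beta> h ** m) ** adj (\<Psi> x))) (at x)" for m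
    by (rule mmul.FDERIV[OF mmul.FDERIV[OF assms has_derivative_const]
          bounded_linear.has_derivative[OF bounded_linear_adj assms]])
  moreover have "\<Psi> x ** m ** adj (\<Psi> x ** \<beta> h) + (\<Psi> x ** 0 + \<Psi> x ** \<beta> h ** m) ** adj (\<Psi> x) =
      \<Psi> x ** (\<beta> h ** m + m ** adj (\<beta> h)) ** adj (\<Psi> x)" for m h
    by (simp add: adj_mult matrix_mul_assoc mmul.add_left mmul.add_right add.commute)
  ultimately have "((\<lambda>y. \<Psi> y ** m ** adj (\<Psi> y)) has_derivative
      (\<lambda>h. \<Psi> x ** (\<beta> h ** m + m ** adj (\<beta> h)) ** adj (\<Psi> x))) (at x)" for m
    by simp
  then show ?thesis
    by (auto simp: act_def fund_vec_def intro!: has_derivative_Pair)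
qed

lemma det_adj: "det (adj g) = cnj (det g)"
  by (simp add: cmat2_simps algebra_simps)

lemma lorentz_congruence:
  assumes "g \<in> SL2"
  shows "lorentz (g ** A ** adj g) (g ** B ** adj g) = lorentz A B"
proof -
  have d: "det (g ** A ** adj g) = det A" for A
    using assms by (simp add: det_mul det_adj SL2_def)
  have "g ** A ** adj g + g ** B ** adj g = g ** (A + B) ** adj g"
    by (simp add: mmul.add_left mmul.add_right)
  then show ?thesis by (simp add: lorentz_def d)
qed

lemma act_base_mem_UH3:
  assumes "g \<in> SL2" shows "act g (e0, e1) \<in> UH3"
proof -
  let ?x = "g ** e0 ** adj g" and ?v = "g ** e1 ** adj g"
  have "?x \<in> Her2" "?v \<in> Her2"
    by (simp_all add: Her2_def cmat2_simps algebra_simps)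
  moreover have "det ?x = 1"
    using assms by (simp add: det_mul det_adj SL2_def e0_def)
  moreover have "Re (trace ?x) > 0"
  proof -
    have "Re (trace ?x) = (cmod (g $ 1 $ 1))\<^sup>2 + (cmod (g $ 1 $ 2))\<^sup>2 + (cmod (g $ 2 $ 1))\<^sup>2 + (cmod (g $ 2 $ 2))\<^sup>2"
      by (simp add: cmat2_simps cmod_def power2_eq_square[of "Re _"] power2_eq_square[of "Im _"])
    moreover have "g $ 1 $ 1 \<noteq> 0 \<or> g $ 1 $ 2 \<noteq> 0" using assms by (auto simp: SL2_def cmat2_simps)
    ultimately show ?thesis
      by (smt (verit) zero_le_power2 zero_less_norm_iff zero_less_power)
  qed
  moreover have "lorentz ?v ?v = 1" "lorentz ?x ?v = 0"
    unfolding lorentz_congruence[OF assms] by (simp_all add: lorentz_def cmat2_simps)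
  ultimately show ?thesis by (simp add: UH3_def H3_def act_def)
qed

text \<open>The contact form is invariant under \<open>SL2\<close>, so it can be evaluated at the base point, where it
  reads off the real part of the diagonal.\<close>

lemma contact_form_act:
  assumes "g \<in> SL2" "trace Z = 0"
  shows "contact_form (act g (e0, e1)) (act g (fund_vec Z)) = 2 * Re (Z $ 1 $ 1)"
proof -
  have "Z $ 2 $ 2 = - Z $ 1 $ 1" using assms(2) by (simp add: cmat2_simps add_eq_0_iff)
  then have "lorentz (Z ** e0 + e0 ** adj Z) e1 = 2 * Re (Z $ 1 $ 1)"
    by (simp add: lorentz_def cmat2_simps algebra_simps)
  then show ?thesis
    by (simp add: contact_form_def act_def fund_vec_def lorentz_congruence[OF assms(1)])
qed

lemma fund_vec_proj_p: "fund_vec (proj_p Z) = fund_vec Z"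
  by (simp add: fund_vec_def proj_p_def proj_h_def cmat2_simps algebra_simps)

lemma proj_entries:
  assumes "trace B = 0"
  shows "proj_h B $ 1 $ 1 = \<i> * Im (B $ 1 $ 1)" "proj_h B $ 2 $ 2 = - \<i> * Im (B $ 1 $ 1)"
    "proj_h B $ 1 $ 2 = 0" "proj_h B $ 2 $ 1 = 0"
    "proj_p B $ 1 $ 1 = Re (B $ 1 $ 1)" "proj_p B $ 2 $ 2 = - Re (B $ 1 $ 1)"
    "proj_p B $ 1 $ 2 = B $ 1 $ 2" "proj_p B $ 2 $ 1 = B $ 2 $ 1"
proof -
  have "B $ 2 $ 2 = - B $ 1 $ 1" using assms by (simp add: cmat2_simps add_eq_0_iff)
  then show "proj_h B $ 1 $ 1 = \<i> * Im (B $ 1 $ 1)" "proj_h B $ 2 $ 2 = - \<i> * Im (B $ 1 $ 1)"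
    "proj_h B $ 1 $ 2 = 0" "proj_h B $ 2 $ 1 = 0"
    "proj_p B $ 1 $ 1 = Re (B $ 1 $ 1)" "proj_p B $ 2 $ 2 = - Re (B $ 1 $ 1)"
    "proj_p B $ 1 $ 2 = B $ 1 $ 2" "proj_p B $ 2 $ 1 = B $ 2 $ 1"
    by (simp_all add: proj_p_def proj_h_def sl2_inner_def cmat2_simps complex_eq_iff)
qed

lemma sl2_inner_proj_p:
  assumes "trace B = 0"
  shows "sl2_inner (proj_p B) (proj_p B) = (Re (B $ 1 $ 1))\<^sup>2 + Re (B $ 1 $ 2 * B $ 2 $ 1)"
  by (simp add: sl2_inner_def trace_def sum_2 matrix_matrix_mult_def proj_entries[OF assms]
      power2_eq_square field_simps)

text \<open>Elements of \<open>lie_h\<close> act trivially at the base point, so the metric sees only \<open>proj_p B\<close>;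
  the right-hand side is its square for \<open>sl2_inner\<close>, written in entries.\<close>

lemma UH3_metric_frame:
  assumes "g \<in> SL2" "trace B = 0"
  shows "UH3_metric (act g (e0, e1)) (act g (fund_vec B)) (act g (fund_vec B)) =
         (Re (B $ 1 $ 1))\<^sup>2 + Re (B $ 1 $ 2 * B $ 2 $ 1)"
proof -
  have "proj_p B \<in> lie_p" using assms(2) by (simp add: proj_p_mem sl2_def)
  then show ?thesis
    using UH3_metric_act[OF assms(1), of "proj_p B" "proj_p B"]
    by (simp add: fund_vec_proj_p sl2_inner_proj_p[OF assms(2)])
qed

section \<open>The Maurer-Cartan equation of a frame\<close>

locale SL2_frame =
  fixes D :: "complex set" and \<Phi> :: "complex \<Rightarrow> cmat2"
  assumes open_D: "open D" and smooth_\<Phi>: "smooth_on D \<Phi>" and \<Phi>_SL2: "\<And>z. z \<in> D \<Longrightarrow> \<Phi> z \<in> SL2"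
begin

abbreviation \<alpha> :: form1 where "\<alpha> \<equiv> mc_form \<Phi>"

lemma C_k_\<Phi>: "C_k_on k D \<Phi>"
  using smooth_\<Phi> by (simp add: smooth_on_def)

lemma \<alpha>_eq: "z \<in> D \<Longrightarrow> \<alpha> z u = cofactor (\<Phi> z) ** frechet_derivative \<Phi> (at z) u"
  by (simp add: mc_form_def matrix_inv_SL2 \<Phi>_SL2)

lemma \<Phi>_has_derivative:
  assumes z: "z \<in> D"
  shows "(\<Phi> has_derivative (\<lambda>u. \<Phi> z ** \<alpha> z u)) (at z)"
proof -
  have "\<Phi> z ** \<alpha> z u = frechet_derivative \<Phi> (at z) u" for u
    by (simp add: \<alpha>_eq[OF z] matrix_mul_assoc cofactor_mult[OF \<Phi>_SL2[OF z]])
  then show ?thesis using C_k_on_Suc_has_derivative[OF C_k_\<Phi> z] by (simp add: eta_contract_eq)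
qed

lemma C_k_\<alpha>: "u \<in> Basis \<Longrightarrow> C_k_on k D (\<lambda>z. \<alpha> z u)"
  by (rule C_k_on_cong[OF open_D \<alpha>_eq[symmetric]], assumption,
      intro C_k_on_bilinear[OF bounded_bilinear_cmat2_mult open_D]
        C_k_on_bounded_linear[OF bounded_linear_cofactor open_D C_k_\<Phi>])
    (use C_k_\<Phi>[of "Suc k"] in simp)

lemma linear_\<alpha>: "z \<in> D \<Longrightarrow> linear (\<alpha> z)"
proof -
  assume z: "z \<in> D"
  interpret f: linear "frechet_derivative \<Phi> (at z)"
    by (rule has_derivative_linear[OF C_k_on_Suc_has_derivative[OF C_k_\<Phi> z]])
  show "linear (\<alpha> z)"
    by (auto intro!: linearI simp: \<alpha>_eq[OF z] f.add f.scaleR matrix_add_ldistrib cmat2_simps algebra_simps)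
qed

lemma trace_\<alpha>:
  assumes z: "z \<in> D"
  shows "trace (\<alpha> z u) = 0"
proof -
  let ?d = "\<lambda>u. \<Phi> z ** \<alpha> z u"
  note e = bounded_linear.has_derivative[OF bounded_linear_entry \<Phi>_has_derivative[OF z]]
  have 1: "((\<lambda>y. \<Phi> y $ 1 $ 1 * \<Phi> y $ 2 $ 2 - \<Phi> y $ 1 $ 2 * \<Phi> y $ 2 $ 1) has_derivative
     (\<lambda>u. (\<Phi> z $ 1 $ 1 * ?d u $ 2 $ 2 + ?d u $ 1 $ 1 * \<Phi> z $ 2 $ 2) -
       (\<Phi> z $ 1 $ 2 * ?d u $ 2 $ 1 + ?d u $ 1 $ 2 * \<Phi> z $ 2 $ 1))) (at z)"
    by (intro has_derivative_diff has_derivative_mult e)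
  have "((\<lambda>y. \<Phi> y $ 1 $ 1 * \<Phi> y $ 2 $ 2 - \<Phi> y $ 1 $ 2 * \<Phi> y $ 2 $ 1) has_derivative (\<lambda>u. 0)) (at z)"
    by (rule has_derivative_transform_within_open[OF has_derivative_const[of 1] open_D z])
      (use \<Phi>_SL2 in \<open>simp add: SL2_def det_2\<close>)
  from fun_cong[OF has_derivative_unique[OF 1 this], of u]
  have "(\<Phi> z $ 1 $ 1 * ?d u $ 2 $ 2 + ?d u $ 1 $ 1 * \<Phi> z $ 2 $ 2) -
       (\<Phi> z $ 1 $ 2 * ?d u $ 2 $ 1 + ?d u $ 1 $ 2 * \<Phi> z $ 2 $ 1) = 0"
    by simp
  moreover have "\<Phi> z $ 1 $ 1 * \<Phi> z $ 2 $ 2 - \<Phi> z $ 1 $ 2 * \<Phi> z $ 2 $ 1 = 1"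
    using \<Phi>_SL2[OF z] by (simp add: SL2_def det_2)
  ultimately show ?thesis
    unfolding trace_def sum_2 matrix_matrix_mult_def vec_lambda_beta by algebra
qed

lemma \<alpha>_22: "z \<in> D \<Longrightarrow> \<alpha> z u $ 2 $ 2 = - \<alpha> z u $ 1 $ 1"
  using trace_\<alpha> by (simp add: trace_def sum_2 add_eq_0_iff)

abbreviation d\<alpha> :: "complex \<Rightarrow> complex \<Rightarrow> complex \<Rightarrow> cmat2" where
  "d\<alpha> z u v \<equiv> frechet_derivative (\<lambda>y. \<alpha> y v) (at z) u"

lemma \<alpha>_has_derivative:
  "z \<in> D \<Longrightarrow> v \<in> Basis \<Longrightarrow> ((\<lambda>y. \<alpha> y v) has_derivative (\<lambda>u. d\<alpha> z u v)) (at z)"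
  using C_k_on_Suc_has_derivative[OF C_k_\<alpha>] by (simp add: eta_contract_eq)

text \<open>The flatness of \<open>\<alpha>\<close>: the second derivatives of \<open>\<Phi>\<close> cancel, and the derivative of the
  inverse contributes the bracket.\<close>

lemma maurer_cartan:
  assumes z: "z \<in> D" and uv: "u \<in> Basis" "v \<in> Basis"
  shows "d\<alpha> z u v - d\<alpha> z v u + bracket (\<alpha> z u) (\<alpha> z v) = 0"
proof -
  let ?d = "\<lambda>u y. frechet_derivative \<Phi> (at y) u"
  let ?g = "cofactor (\<Phi> z)"
  have inv: "?g ** \<Phi> z = mat 1" "\<Phi> z ** ?g = mat 1" by (rule cofactor_mult[OF \<Phi>_SL2[OF z]])+
  note cof = bounded_linear.has_derivative[OF bounded_linear_cofactor \<Phi>_has_derivative[OF z]]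
  \<comment> \<open>The derivative of the inverse, read off from \<open>cofactor \<Phi> ** \<Phi> = mat 1\<close>; note that
      \<open>cofactor\<close> is linear.\<close>
  have c: "cofactor (\<Phi> z ** \<alpha> z u) = - (\<alpha> z u ** ?g)" for u
  proof -
    have "((\<lambda>y. cofactor (\<Phi> y) ** \<Phi> y) has_derivative (\<lambda>u. 0)) (at z)"
      by (rule has_derivative_transform_within_open[OF has_derivative_const[of "mat 1"] open_D z])
        (simp add: cofactor_mult \<Phi>_SL2)
    from fun_cong[OF has_derivative_unique[OF this mmul.FDERIV[OF cof \<Phi>_has_derivative[OF z]]], of u]
    have "?g ** (\<Phi> z ** \<alpha> z u) + cofactor (\<Phi> z ** \<alpha> z u) ** \<Phi> z = 0" by simp
    then have "cofactor (\<Phi> z ** \<alpha> z u) ** \<Phi> z = - \<alpha> z u"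
      by (simp add: matrix_mul_assoc inv matrix_mul_lid add_eq_0_iff)
    then have "(cofactor (\<Phi> z ** \<alpha> z u) ** \<Phi> z) ** ?g = - \<alpha> z u ** ?g" by simp
    then show ?thesis by (simp add: matrix_mul_assoc[symmetric] inv matrix_mul_rid
          mmul.minus_left)
  qed
  have d\<Phi>: "?d v z = \<Phi> z ** \<alpha> z v" for v
    by (simp add: \<alpha>_eq[OF z] matrix_mul_assoc inv matrix_mul_lid)
  have d: "d\<alpha> z u v = ?g ** frechet_derivative (?d v) (at z) u - \<alpha> z u ** \<alpha> z v"
    if "u \<in> Basis" "v \<in> Basis" for u v
  proof -
    have "(?d v has_derivative frechet_derivative (?d v) (at z)) (at z)"
      by (rule C_k_on_Suc_has_derivative[OF _ z, of 0]) (use C_k_\<Phi>[of "Suc (Suc 0)"] that in simp)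
    from has_derivative_transform_within_open[OF mmul.FDERIV[OF cof this] open_D z \<alpha>_eq[symmetric]]
    have "((\<lambda>y. \<alpha> y v) has_derivative
       (\<lambda>u. ?g ** frechet_derivative (?d v) (at z) u + cofactor (\<Phi> z ** \<alpha> z u) ** ?d v z)) (at z)"
      by simp
    from fun_cong[OF frechet_derivative_at[OF this], of u] show ?thesis
      by (simp add: c d\<Phi> matrix_mul_assoc[symmetric] mmul.minus_left)
         (simp add: matrix_mul_assoc inv matrix_mul_lid)
  qed
  have cancel: "M - A - (M - B) + (A - B) = 0" for M A B :: cmat2 by simp
  show ?thesis
    by (simp only: d[OF uv] d[OF uv(2,1)] mixed_derivatives_commute[OF open_D C_k_\<Phi> uv z]
        bracket_def cancel)
qed

end

section \<open>The first variation of the energy\<close>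

text \<open>For \<open>w * v = 0\<close> these matrices are nilpotent, so \<open>mat 1 + s *\<^sub>R offdiag w v\<close> is the
  one-parameter group that they generate. The matrices with \<open>v = 0\<close> and those with \<open>w = 0\<close>
  together span the off-diagonal part of \<open>lie_p\<close>.\<close>

definition offdiag :: "complex \<Rightarrow> complex \<Rightarrow> cmat2" where
  "offdiag w v = vector [vector [0, w], vector [v, 0]]"

lemma scaleR_offdiag: "c *\<^sub>R offdiag w v = offdiag (c * w) (c * v)"
  unfolding vec_eq_iff forall_2 vector_scaleR_component
  by (simp add: offdiag_def) (simp add: scaleR_conv_of_real)

locale legendre_harmonic_frame = SL2_frame +
  fixes F :: "complex \<Rightarrow> cmat2 \<times> cmat2"
  assumes F_eq: "\<And>z. z \<in> D \<Longrightarrow> F z = act (\<Phi> z) (e0, e1)"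
    and harmonic: "harmonic_on D F" and legendre: "legendre_on D F"
begin

text \<open>The Legendre condition puts the diagonal of \<open>\<alpha>\<close> into \<open>lie_h\<close>; the \<open>lie_p\<close>-part is then
  off-diagonal.\<close>

lemma legendre_\<alpha>:
  assumes z: "z \<in> D"
  shows "Re (\<alpha> z u $ 1 $ 1) = 0"
proof -
  have "(F has_derivative (\<lambda>h. act (\<Phi> z) (fund_vec (\<alpha> z h)))) (at z)"
    by (rule has_derivative_transform_within_open[OF has_derivative_act[OF \<Phi>_has_derivative[OF z]] open_D z])
      (simp add: F_eq)
  then have "frechet_derivative F (at z) u = act (\<Phi> z) (fund_vec (\<alpha> z u))"
    using frechet_derivative_at by metis
  moreover have "contact_form (F z) (frechet_derivative F (at z) u) = 0"
    using legendre z by (simp add: legendre_on_def)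
  ultimately show ?thesis
    using contact_form_act[OF \<Phi>_SL2[OF z] trace_\<alpha>[OF z], of u] by (simp add: F_eq[OF z])
qed

text \<open>Multiplying the frame on the right by unipotent matrices gives variations that are polynomial in
  the parameter \<open>t\<close> and stay in \<open>SL2\<close>, without recourse to the matrix exponential.\<close>

definition varied_frame :: "complex \<Rightarrow> complex \<Rightarrow> (complex \<Rightarrow> real) \<Rightarrow> real \<Rightarrow> complex \<Rightarrow> cmat2" where
  "varied_frame w v \<phi> t z = \<Phi> z ** (mat 1 + (t * \<phi> z) *\<^sub>R offdiag w v)"

lemma varied_frame_SL2:
  assumes "z \<in> D" "w * v = 0"
  shows "varied_frame w v \<phi> t z \<in> SL2"
proof -
  have "det (mat 1 + (t * \<phi> z) *\<^sub>R offdiag w v) = 1"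
    using assms(2) unfolding scaleR_offdiag by (auto simp: det_2 offdiag_def mat_def)
  then show ?thesis
    using \<Phi>_SL2[OF assms(1)] by (simp add: varied_frame_def SL2_def det_mul)
qed

text \<open>The logarithmic derivative of the varied frame is the gauge transform of \<open>\<alpha>\<close> by the unipotent
  factor; that factor and its inverse are \<open>mat 1 \<plusminus> s *\<^sub>R offdiag w v\<close>.\<close>

lemma varied_frame_has_derivative:
  fixes \<phi> :: "complex \<Rightarrow> real"
  assumes z: "z \<in> D" and wv: "w * v = 0" and \<phi>: "(\<phi> has_derivative \<phi>') (at z)"
  shows "(varied_frame w v \<phi> t has_derivative
    (\<lambda>u. varied_frame w v \<phi> t z **
      ((mat 1 - (t * \<phi> z) *\<^sub>R offdiag w v) ** \<alpha> z u ** (mat 1 + (t * \<phi> z) *\<^sub>R offdiag w v)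
        + (t * \<phi>' u) *\<^sub>R offdiag w v))) (at z)"
proof -
  let ?X = "offdiag w v" and ?s = "t * \<phi> z"
  have "(varied_frame w v \<phi> t has_derivative
      (\<lambda>u. \<Phi> z ** ((t * \<phi>' u) *\<^sub>R ?X) + (\<Phi> z ** \<alpha> z u) ** (mat 1 + ?s *\<^sub>R ?X))) (at z)"
    unfolding varied_frame_def[abs_def]
    by (rule mmul.FDERIV[OF \<Phi>_has_derivative[OF z]]) (auto intro!: derivative_eq_intros \<phi>)
  moreover have "(mat 1 + ?s *\<^sub>R ?X) ** (mat 1 - ?s *\<^sub>R ?X) = mat 1"
      "(mat 1 + ?s *\<^sub>R ?X) ** ?X = ?X"
    using wv by (auto simp: offdiag_def cmat2_simps)
  then have "varied_frame w v \<phi> t z ** ((mat 1 - ?s *\<^sub>R ?X) ** A ** (mat 1 + ?s *\<^sub>R ?X) + c *\<^sub>R ?X) =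
      \<Phi> z ** (c *\<^sub>R ?X) + (\<Phi> z ** A) ** (mat 1 + ?s *\<^sub>R ?X)" for A c
    unfolding varied_frame_def mmul.add_right[of _ _ "c *\<^sub>R ?X"] mmul.scaleR_right
    by (simp add: matrix_mul_assoc[symmetric] add.commute)
       (metis matrix_mul_assoc matrix_mul_lid)
  ultimately show ?thesis by simp
qed

text \<open>The energy density of the varied map is quadratic in \<open>t\<close>: all terms of higher order contain the
  factor \<open>w * v\<close>.\<close>

lemma varied_metric:
  fixes \<phi> :: "complex \<Rightarrow> real" and t :: real and u :: complex
  assumes z: "z \<in> D" and wv: "w * v = 0" and \<phi>: "(\<phi> has_derivative \<phi>') (at z)"
  defines "G \<equiv> \<lambda>z. act (varied_frame w v \<phi> t z) (e0, e1)"
    and "a \<equiv> \<lambda>i j. \<alpha> z u $ i $ j"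
  shows "UH3_metric (G z) (frechet_derivative G (at z) u) (frechet_derivative G (at z) u) =
    Re (a 1 2 * a 2 1) +
    t * (\<phi>' u * Re (w * a 2 1 + v * a 1 2) + \<phi> z * Re (2 * a 1 1 * (w * a 2 1 - v * a 1 2))) +
    t\<^sup>2 * ((\<phi> z)\<^sup>2 * ((Re (v * a 1 2 - w * a 2 1))\<^sup>2 - Re ((w * a 2 1)\<^sup>2 + (v * a 1 2)\<^sup>2)))"
proof -
  let ?X = "offdiag w v" and ?s = "t * \<phi> z"
  define B where "B u = (mat 1 - ?s *\<^sub>R ?X) ** \<alpha> z u ** (mat 1 + ?s *\<^sub>R ?X) + (t * \<phi>' u) *\<^sub>R ?X" for u
  note \<Psi> = varied_frame_has_derivative[OF z wv \<phi>, of t, folded B_def]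
  have dG: "frechet_derivative G (at z) u = act (varied_frame w v \<phi> t z) (fund_vec (B u))"
    unfolding G_def using fun_cong[OF frechet_derivative_at[OF has_derivative_act[OF \<Psi>]]] by metis
  have a: "\<alpha> z u $ 1 $ 1 = a 1 1" "\<alpha> z u $ 1 $ 2 = a 1 2" "\<alpha> z u $ 2 $ 1 = a 2 1" "\<alpha> z u $ 2 $ 2 = - a 1 1"
    by (simp_all add: a_def \<alpha>_22[OF z])
  have r: "Re (a 1 1) = 0" using legendre_\<alpha>[OF z] by (simp add: a_def)
  have B: "B u $ 1 $ 1 = a 1 1 + ?s *\<^sub>R (v * a 1 2 - w * a 2 1)"
      "B u $ 1 $ 2 = a 1 2 + t *\<^sub>R (\<phi>' u *\<^sub>R w + \<phi> z *\<^sub>R (2 * a 1 1 * w)) - ?s\<^sup>2 *\<^sub>R (w\<^sup>2 * a 2 1)"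
      "B u $ 2 $ 1 = a 2 1 + t *\<^sub>R (\<phi>' u *\<^sub>R v - \<phi> z *\<^sub>R (2 * a 1 1 * v)) - ?s\<^sup>2 *\<^sub>R (v\<^sup>2 * a 1 2)"
      "B u $ 2 $ 2 = - (B u $ 1 $ 1)"
    using wv unfolding B_def scaleR_offdiag
    by (auto simp: offdiag_def matrix_matrix_mult_def sum_2 mat_def a
        scaleR_conv_of_real power2_eq_square algebra_simps)
  have "trace (B u) = 0" using B(4) by (simp add: trace_def sum_2)
  from UH3_metric_frame[OF varied_frame_SL2[OF z wv] this, of \<phi> t]
  have "UH3_metric (G z) (frechet_derivative G (at z) u) (frechet_derivative G (at z) u) =
     (Re (B u $ 1 $ 1))\<^sup>2 + Re (B u $ 1 $ 2 * B u $ 2 $ 1)"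
    by (simp add: dG) (simp add: G_def)
  also have "(Re (B u $ 1 $ 1))\<^sup>2 = t\<^sup>2 * ((\<phi> z)\<^sup>2 * (Re (v * a 1 2 - w * a 2 1))\<^sup>2)"
    unfolding B by (simp add: r power_mult_distrib)
  also have "B u $ 1 $ 2 * B u $ 2 $ 1 = a 1 2 * a 2 1 +
     t *\<^sub>R (\<phi>' u *\<^sub>R (w * a 2 1 + v * a 1 2) + \<phi> z *\<^sub>R (2 * a 1 1 * (w * a 2 1 - v * a 1 2)))
     - (t\<^sup>2 * (\<phi> z)\<^sup>2) *\<^sub>R ((w * a 2 1)\<^sup>2 + (v * a 1 2)\<^sup>2)"
  proof -
    consider "w = 0" | "v = 0" using wv by auto
    then show ?thesis
      by cases (simp_all add: B scaleR_conv_of_real power2_eq_square algebra_simps)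
  qed
  finally show ?thesis by (simp add: algebra_simps)
qed

lemma compact_variation_varied_frame:
  assumes r: "0 < r" "cball a r \<subseteq> D" and wv: "w * v = 0"
  shows "compact_variation D F (cball a r) (\<lambda>t z. act (varied_frame w v (bump a r) t z) (e0, e1))"
proof -
  let ?G = "\<lambda>t z. act (varied_frame w v (bump a r) t z) (e0, e1)"
  let ?S = "{-1<..<1::real} \<times> D"
  have S: "open ?S" using open_D by (intro open_Times) auto
  have "C_k_on k ?S (\<lambda>p. act (\<Phi> (snd p) ** (mat 1 + (fst p * bump a r (snd p)) *\<^sub>R offdiag w v)) (e0, e1))" for k
    by (intro C_k_on_act S C_k_on_bilinear[OF bounded_bilinear_cmat2_mult] C_k_on_add C_k_on_const
        C_k_on_bilinear[OF bounded_bilinear_scaleR] C_k_on_bilinear[OF bounded_bilinear_mult]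
        C_k_on_snd[OF open_D] C_k_\<Phi> C_k_on_linear[OF bounded_linear_fst]
        C_k_on_subset[OF C_k_on_bump] subset_UNIV open_greaterThanLessThan)
  then have "smooth_on ?S (\<lambda>(t, z). ?G t z)"
    by (simp add: smooth_on_def case_prod_unfold varied_frame_def)
  moreover have "?G t z = F z" if "z \<in> D" "t = 0 \<or> z \<notin> cball a r" for t z
    using that bump_eq_0[of r z a] r(1) by (auto simp: varied_frame_def F_eq matrix_mul_rid)
  ultimately show ?thesis
    unfolding compact_variation_def
    using r act_base_mem_UH3[OF varied_frame_SL2[OF _ wv]]
    by (auto intro!: exI[of _ 1])
qed

lemma continuous_on_\<alpha>: "u \<in> Basis \<Longrightarrow> continuous_on D (\<lambda>z. \<alpha> z u $ i $ j)"
  by (intro continuous_on_component C_k_on_continuous[OF C_k_\<alpha>])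

text \<open>Since the energy is a quadratic polynomial in \<open>t\<close>, its derivative at \<open>0\<close> is the linear
  coefficient, and no differentiation under the integral sign occurs.\<close>

lemma first_variation:
  assumes r: "0 < r" "cball a r \<subseteq> D" and wv: "w * v = 0"
  defines "c \<equiv> \<lambda>u z. frechet_derivative (bump a r) (at z) u * Re (w * \<alpha> z u $ 2 $ 1 + v * \<alpha> z u $ 1 $ 2) +
      bump a r z * Re (2 * \<alpha> z u $ 1 $ 1 * (w * \<alpha> z u $ 2 $ 1 - v * \<alpha> z u $ 1 $ 2))"
  shows "(LINT z:cball a r|lborel. c 1 z + c \<i> z) = 0"
proof -
  let ?K = "cball a r" and ?\<phi> = "bump a r"
  let ?G = "\<lambda>t z. act (varied_frame w v ?\<phi> t z) (e0, e1)"
  define b where "b u z = Re (\<alpha> z u $ 1 $ 2 * \<alpha> z u $ 2 $ 1)" for u z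
  define d where "d u z = (?\<phi> z)\<^sup>2 * ((Re (v * \<alpha> z u $ 1 $ 2 - w * \<alpha> z u $ 2 $ 1))\<^sup>2 -
      Re ((w * \<alpha> z u $ 2 $ 1)\<^sup>2 + (v * \<alpha> z u $ 1 $ 2)\<^sup>2))" for u z
  have \<phi>: "(?\<phi> has_derivative frechet_derivative ?\<phi> (at z)) (at z)" for z
    by (rule C_k_on_Suc_has_derivative[OF C_k_on_bump]) simp
  have metric: "UH3_metric (?G t z) (frechet_derivative (?G t) (at z) u) (frechet_derivative (?G t) (at z) u) =
      b u z + t * c u z + t\<^sup>2 * d u z" if "z \<in> ?K" for t z u
    using varied_metric[OF _ wv \<phi>, of z t u] that r(2) by (auto simp: b_def c_def d_def)
  have cont: "continuous_on D (b u)" "continuous_on D (c u)" "continuous_on D (d u)" if "u \<in> Basis" for u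
    using C_k_on_bump[of "Suc 0" a r] that C_k_on_continuous[OF C_k_on_bump[of 0 a r]]
    unfolding b_def c_def d_def
    by (auto intro!: continuous_intros continuous_on_\<alpha> that intro: continuous_on_subset)
  have int: "set_integrable lborel ?K (\<lambda>z. f 1 z + f \<i> z)" if "\<And>u. u \<in> Basis \<Longrightarrow> continuous_on D (f u)" for f :: "complex \<Rightarrow> complex \<Rightarrow> real"
    unfolding set_integrable_def
    by (intro borel_integrable_compact continuous_on_add continuous_on_subset[OF that r(2)])
      (auto simp: Basis_complex_def)
  define E where "E f = (LINT z:?K|lborel. f 1 z + f \<i> z)" for f :: "complex \<Rightarrow> complex \<Rightarrow> real"
  have energy: "energy ?K (?G t) = (E b + t * E c + t\<^sup>2 * E d) / 2" for t
  proof -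
    have "energy ?K (?G t) =
      1/2 * (LINT z:?K|lborel. (b 1 z + b \<i> z) + (t * (c 1 z + c \<i> z) + t\<^sup>2 * (d 1 z + d \<i> z)))"
      unfolding energy_def
      by (intro arg_cong[of _ _ "(*) (1/2)"] set_lebesgue_integral_cong)
        (auto simp: metric algebra_simps)
    then show ?thesis
      using int[of b] int[of c] int[of d] cont by (simp add: E_def set_integral_add)
  qed
  have "((\<lambda>t. energy ?K (?G t)) has_real_derivative 0) (at 0)"
    using harmonic compact_variation_varied_frame[OF r wv] unfolding harmonic_on_def by blast
  then have "((\<lambda>t. (E b + t * E c + t\<^sup>2 * E d) / 2) has_real_derivative 0) (at 0)"
    by (simp only: energy)
  moreover have "((\<lambda>t. (E b + t * E c + t\<^sup>2 * E d) / 2) has_real_derivative E c / 2) (at 0)"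
    by (auto intro!: derivative_eq_intros)
  ultimately have "E c / 2 = 0" using DERIV_unique by blast
  then show ?thesis by (simp add: E_def)
qed

text \<open>In the first variation, integration by parts moves the derivative from the bump function to
  \<open>\<alpha>\<close>; the fundamental lemma then gives a pointwise equation, tested against \<open>offdiag w v\<close>.\<close>

lemma euler_lagrange_weak:
  assumes z: "z \<in> D" and wv: "w * v = 0"
  defines "e \<equiv> \<lambda>z u. Re (w * d\<alpha> z u u $ 2 $ 1 + v * d\<alpha> z u u $ 1 $ 2) -
      Re (2 * \<alpha> z u $ 1 $ 1 * (w * \<alpha> z u $ 2 $ 1 - v * \<alpha> z u $ 1 $ 2))"
  shows "e z 1 + e z \<i> = 0"
proof (rule fundamental_lemma_bump[OF open_D _ _ z])
  define P where "P u z = Re (w * \<alpha> z u $ 2 $ 1 + v * \<alpha> z u $ 1 $ 2)" for u z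
  define R where "R u z = Re (2 * \<alpha> z u $ 1 $ 1 * (w * \<alpha> z u $ 2 $ 1 - v * \<alpha> z u $ 1 $ 2))" for u z
  have bl: "bounded_linear (\<lambda>A :: cmat2. Re (w * A $ 2 $ 1 + v * A $ 1 $ 2))"
    by (intro bounded_linear_compose[OF bounded_linear_Re] bounded_linear_add
        bounded_linear_const_mult bounded_linear_entry)
  have P: "C_k_on k D (P u)" if "u \<in> Basis" for u k
    unfolding P_def by (rule C_k_on_bounded_linear[OF bl open_D C_k_\<alpha>[OF that]])
  have dP: "frechet_derivative (P u) (at z) u = Re (w * d\<alpha> z u u $ 2 $ 1 + v * d\<alpha> z u u $ 1 $ 2)"
    if "u \<in> Basis" "z \<in> D" for u z
    unfolding P_def using C_k_\<alpha>[OF that(1), of "Suc 0"] that(2)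
    by (intro frechet_derivative_bounded_linear[OF bl]) simp
  have e: "e z u = frechet_derivative (P u) (at z) u - R u z" if "u \<in> Basis" "z \<in> D" for z u
    by (simp only: dP[OF that] e_def R_def)
  have cR: "continuous_on D (R u)" if "u \<in> Basis" for u
    unfolding R_def by (intro continuous_intros continuous_on_\<alpha> that)
  have cdP: "continuous_on D (\<lambda>z. frechet_derivative (P u) (at z) u)" if "u \<in> Basis" for u
    using P[OF that, of "Suc 0"] that by simp
  have B: "(1::complex) \<in> Basis" "\<i> \<in> Basis" by (simp_all add: Basis_complex_def)
  have "continuous_on D (\<lambda>z. e z u)" if "u \<in> Basis" for u
    by (rule continuous_on_eq[OF continuous_on_diff[OF cdP[OF that] cR[OF that]]]) (simp add: e that)
  then show "continuous_on D (\<lambda>z. e z 1 + e z \<i>)" using B by (intro continuous_on_add)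
  fix a r assume r: "0 < r" "cball a r \<subseteq> D"
  let ?K = "cball a r" and ?\<phi> = "bump a r"
  let ?dP = "\<lambda>u z. frechet_derivative (P u) (at z) u"
  let ?d\<phi> = "\<lambda>u z. frechet_derivative ?\<phi> (at z) u"
  have cont\<phi>: "continuous_on UNIV ?\<phi>" "u \<in> Basis \<Longrightarrow> continuous_on UNIV (?d\<phi> u)" for u
    using C_k_on_continuous[OF C_k_on_bump] C_k_on_bump[of "Suc 0" a r] by auto
  have int: "set_integrable lborel ?K (\<lambda>z. f z * g z)"
    if "continuous_on UNIV f" "continuous_on D g" for f g :: "complex \<Rightarrow> real"
    unfolding set_integrable_def
    by (intro borel_integrable_compact compact_cball continuous_on_mult
        continuous_on_subset[OF that(1) subset_UNIV] continuous_on_subset[OF that(2) r(2)])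
  have ibp: "(LINT z:?K|lborel. ?d\<phi> u z * P u z) = - (LINT z:?K|lborel. ?\<phi> z * ?dP u z)" if "u \<in> Basis" for u
    by (rule integration_by_parts[OF open_D compact_cball r(2) C_k_on_bump
          bump_eq_0[OF less_imp_le[OF r(1)]] P[OF that] that])
  let ?I = "\<lambda>f. LINT z:?K|lborel. f z"
  have "?I (\<lambda>z. (?d\<phi> 1 z * P 1 z + ?\<phi> z * R 1 z) + (?d\<phi> \<i> z * P \<i> z + ?\<phi> z * R \<i> z)) = 0"
    using first_variation[OF r wv] by (simp add: P_def R_def)
  then have 1: "?I (\<lambda>z. ?d\<phi> 1 z * P 1 z) + ?I (\<lambda>z. ?\<phi> z * R 1 z) +
      (?I (\<lambda>z. ?d\<phi> \<i> z * P \<i> z) + ?I (\<lambda>z. ?\<phi> z * R \<i> z)) = 0"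
    using int[OF cont\<phi>(2) C_k_on_continuous[OF P]] int[OF cont\<phi>(1) cR] B
    by (simp add: set_integral_add)
  have "?I (\<lambda>z. ?\<phi> z * (e z 1 + e z \<i>)) =
      ?I (\<lambda>z. (?\<phi> z * ?dP 1 z - ?\<phi> z * R 1 z) + (?\<phi> z * ?dP \<i> z - ?\<phi> z * R \<i> z))"
    using r(2) B by (intro set_lebesgue_integral_cong) (auto simp: e algebra_simps subset_iff)
  also have "\<dots> = (?I (\<lambda>z. ?\<phi> z * ?dP 1 z) - ?I (\<lambda>z. ?\<phi> z * R 1 z)) +
      (?I (\<lambda>z. ?\<phi> z * ?dP \<i> z) - ?I (\<lambda>z. ?\<phi> z * R \<i> z))"
    using int[OF cont\<phi>(1) cdP] int[OF cont\<phi>(1) cR] B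
    by (simp add: set_integral_add set_integral_diff)
  also have "\<dots> = 0" using 1 ibp B by simp
  finally show "?I (\<lambda>z. ?\<phi> z * (e z 1 + e z \<i>)) = 0" .
qed

text \<open>The off-diagonal entries of the harmonic map equation
  \<open>\<Sum>u\<in>{1, \<i>}. d\<alpha>\<^sub>p z u u + bracket (\<alpha>\<^sub>h z u) (\<alpha>\<^sub>p z u) = 0\<close>. A complex equation follows from the real
  parts of its multiples by \<open>1\<close> and \<open>\<i>\<close>.\<close>

lemma euler_lagrange:
  assumes z: "z \<in> D"
  shows "d\<alpha> z 1 1 $ 1 $ 2 + d\<alpha> z \<i> \<i> $ 1 $ 2 =
      - 2 * (\<alpha> z 1 $ 1 $ 1 * \<alpha> z 1 $ 1 $ 2 + \<alpha> z \<i> $ 1 $ 1 * \<alpha> z \<i> $ 1 $ 2)"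
    and "d\<alpha> z 1 1 $ 2 $ 1 + d\<alpha> z \<i> \<i> $ 2 $ 1 =
      2 * (\<alpha> z 1 $ 1 $ 1 * \<alpha> z 1 $ 2 $ 1 + \<alpha> z \<i> $ 1 $ 1 * \<alpha> z \<i> $ 2 $ 1)"
  using euler_lagrange_weak[OF z, of 0 1] euler_lagrange_weak[OF z, of 0 \<i>]
    euler_lagrange_weak[OF z, of 1 0] euler_lagrange_weak[OF z, of \<i> 0]
  by (simp_all add: complex_eq_iff algebra_simps)

end

section \<open>Flatness of the loop of forms\<close>

text \<open>The value of \<open>loop_form c \<alpha> z u\<close> as a function of the coefficients \<open>A = \<alpha> z 1\<close> and
  \<open>B = \<alpha> z \<i>\<close>, for a form with trace zero and diagonal in \<open>lie_h\<close>. It is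
  real linear in \<open>(A, B)\<close>, hence commutes with differentiation in \<open>z\<close>.\<close>

definition loop_value :: "complex \<Rightarrow> complex \<Rightarrow> cmat2 \<Rightarrow> cmat2 \<Rightarrow> cmat2" where
  "loop_value c u A B =
    (let h = Re u *\<^sub>R A $ 1 $ 1 + Im u *\<^sub>R B $ 1 $ 1;
         p = \<lambda>i j. inverse c * (u * ((1/2) * (A $ i $ j - \<i> * B $ i $ j))) +
                      c * (cnj u * ((1/2) * (A $ i $ j + \<i> * B $ i $ j)))
     in vector [vector [h, p 1 2], vector [p 2 1, - h]])"

lemma loop_value_entries:
  "loop_value c u A B $ 1 $ 1 = Re u * A $ 1 $ 1 + Im u * B $ 1 $ 1"
  "loop_value c u A B $ 2 $ 2 = - (Re u * A $ 1 $ 1 + Im u * B $ 1 $ 1)"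
  "loop_value c u A B $ 1 $ 2 = inverse 2 * (inverse c * u * (A $ 1 $ 2 - \<i> * B $ 1 $ 2) + c * cnj u * (A $ 1 $ 2 + \<i> * B $ 1 $ 2))"
  "loop_value c u A B $ 2 $ 1 = inverse 2 * (inverse c * u * (A $ 2 $ 1 - \<i> * B $ 2 $ 1) + c * cnj u * (A $ 2 $ 1 + \<i> * B $ 2 $ 1))"
  by (simp_all add: loop_value_def Let_def scaleR_conv_of_real add_divide_distrib ring_distribs mult.assoc)

lemma bounded_linear_loop_value: "bounded_linear (\<lambda>(A, B). loop_value c u A B)"
  unfolding linear_conv_bounded_linear[symmetric]
  by (rule linearI)
    (auto simp: loop_value_def Let_def vec_eq_iff forall_2 algebra_simps)

context legendre_harmonic_frame
begin

lemma loop_form_eq: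
  assumes z: "z \<in> D"
  shows "loop_form c \<alpha> z u = loop_value c u (\<alpha> z 1) (\<alpha> z \<i>)"
proof -
  have u: "u = Re u *\<^sub>R 1 + Im u *\<^sub>R \<i>" by (simp add: complex_eq_iff)
  have "\<alpha> z u = \<alpha> z (Re u *\<^sub>R 1 + Im u *\<^sub>R \<i>)" using u by simp
  also have "\<dots> = Re u *\<^sub>R \<alpha> z 1 + Im u *\<^sub>R \<alpha> z \<i>"
    by (simp only: linear_add[OF linear_\<alpha>[OF z]] linear_scale[OF linear_\<alpha>[OF z]])
  finally have u: "\<alpha> z u $ 1 $ 1 = Re u *\<^sub>R \<alpha> z 1 $ 1 $ 1 + Im u *\<^sub>R \<alpha> z \<i> $ 1 $ 1" by simp
  have h: "\<i> * complex_of_real (Im (\<alpha> z u $ 1 $ 1)) = \<alpha> z u $ 1 $ 1" for u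
    by (simp add: complex_eq_iff legendre_\<alpha>[OF z])
  show ?thesis
    by (simp add: vec_eq_iff forall_2 loop_form_def h_part_def p_part_def part10_def part01_def
        cscale_def proj_entries[OF trace_\<alpha>[OF z]] legendre_\<alpha>[OF z] loop_value_def Let_def h u[symmetric])
qed

lemma ext_deriv_loop_form:
  assumes z: "z \<in> D"
  shows "ext_deriv (loop_form c \<alpha>) z u w =
    loop_value c w (d\<alpha> z u 1) (d\<alpha> z u \<i>) - loop_value c u (d\<alpha> z w 1) (d\<alpha> z w \<i>)"
proof -
  have B: "(1::complex) \<in> Basis" "\<i> \<in> Basis" by (simp_all add: Basis_complex_def)
  have "frechet_derivative (\<lambda>y. loop_form c \<alpha> y w) (at z) u = loop_value c w (d\<alpha> z u 1) (d\<alpha> z u \<i>)" for u w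
  proof -
    have "((\<lambda>y. loop_value c w (\<alpha> y 1) (\<alpha> y \<i>)) has_derivative
        (\<lambda>u. loop_value c w (d\<alpha> z u 1) (d\<alpha> z u \<i>))) (at z)"
      using bounded_linear.has_derivative[OF bounded_linear_loop_value
          has_derivative_Pair[OF \<alpha>_has_derivative[OF z B(1)] \<alpha>_has_derivative[OF z B(2)]], of c w]
      by simp
    then have "((\<lambda>y. loop_form c \<alpha> y w) has_derivative
        (\<lambda>u. loop_value c w (d\<alpha> z u 1) (d\<alpha> z u \<i>))) (at z)"
      by (rule has_derivative_transform_within_open[OF _ open_D z]) (simp add: loop_form_eq)
    from fun_cong[OF frechet_derivative_at[OF this], of u] show ?thesis by simp
  qed
  then show ?thesis by (simp add: ext_deriv_def)
qed

text \<open>Only the bilinear antisymmetric combination \<open>Re u * Im w - Im u * Re w\<close> of the tangent vectors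
  matters. The diagonal entries reduce to those of the Maurer-Cartan equation, in which \<open>c\<close>
  cancels because the bracket of the \<open>(1,0)\<close>- and the \<open>(0,1)\<close>-part carries \<open>inverse c * c\<close>. In
  the off-diagonal entries the coefficients of \<open>inverse c\<close> and of \<open>c\<close> are the two complex
  combinations of the Maurer-Cartan and the harmonic map equation.\<close>

lemma loop_form_flat:
  assumes z: "z \<in> D" and c: "c \<noteq> 0"
  shows "ext_deriv (loop_form c \<alpha>) z u w + (1/2) *\<^sub>R wedge_bracket (loop_form c \<alpha>) (loop_form c \<alpha>) z u w = 0"
proof -
  have B: "(1::complex) \<in> Basis" "\<i> \<in> Basis" by (simp_all add: Basis_complex_def)
  define A1 where "A1 = \<alpha> z 1"
  define A2 where "A2 = \<alpha> z \<i>"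
  define d where "d = d\<alpha> z"
  have A22: "A1 $ 2 $ 2 = - A1 $ 1 $ 1" "A2 $ 2 $ 2 = - A2 $ 1 $ 1"
    by (simp_all add: A1_def A2_def \<alpha>_22[OF z])
  have "d 1 \<i> - d \<i> 1 + bracket A1 A2 = 0"
    unfolding d_def A1_def A2_def by (rule maurer_cartan[OF z B])
  then have mc: "d 1 \<i> $ i $ j = d \<i> 1 $ i $ j - bracket A1 A2 $ i $ j" for i j
    by (simp add: vec_eq_iff algebra_simps eq_diff_eq)
  note mc = mc[unfolded bracket_def matrix_matrix_mult_def sum_2 vector_minus_component vec_lambda_beta]
  have el: "d 1 1 $ 1 $ 2 = - d \<i> \<i> $ 1 $ 2 - 2 * (A1 $ 1 $ 1 * A1 $ 1 $ 2 + A2 $ 1 $ 1 * A2 $ 1 $ 2)"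
    "d 1 1 $ 2 $ 1 = - d \<i> \<i> $ 2 $ 1 + 2 * (A1 $ 1 $ 1 * A1 $ 2 $ 1 + A2 $ 1 $ 1 * A2 $ 2 $ 1)"
    using euler_lagrange[OF z] unfolding d_def A1_def A2_def by algebra+
  have d: "d u v = Re u *\<^sub>R d 1 v + Im u *\<^sub>R d \<i> v" if "v \<in> Basis" for u v
  proof -
    have l: "linear (\<lambda>u. d u v)"
      unfolding d_def by (rule has_derivative_linear[OF \<alpha>_has_derivative[OF z that]])
    have "d u v = d (Re u *\<^sub>R 1 + Im u *\<^sub>R \<i>) v"
      by (rule arg_cong[of _ _ "\<lambda>u. d u v"]) (simp add: complex_eq_iff)
    also have "\<dots> = Re u *\<^sub>R d 1 v + Im u *\<^sub>R d \<i> v"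
      by (simp only: linear_add[OF l] linear_scale[OF l])
    finally show ?thesis .
  qed
  have ext: "ext_deriv (loop_form c \<alpha>) z u w = loop_value c w (d u 1) (d u \<i>) - loop_value c u (d w 1) (d w \<i>)"
    unfolding d_def by (rule ext_deriv_loop_form[OF z])
  have br: "(1/2) *\<^sub>R wedge_bracket (loop_form c \<alpha>) (loop_form c \<alpha>) z u w =
      bracket (loop_value c u A1 A2) (loop_value c w A1 A2)"
  proof -
    have "bracket X Y - bracket Y X = 2 *\<^sub>R bracket X Y" for X Y
      by (simp add: bracket_def scaleR_2)
    then show ?thesis by (simp add: wedge_bracket_def loop_form_eq[OF z] A1_def A2_def)
  qed
  \<comment> \<open>The four entries become polynomial identities once \<open>1 / c\<close>, \<open>1 / 2\<close> and the real and
      imaginary parts of \<open>u\<close> and \<open>w\<close> are variables of their own, subject to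
      \<open>c * b = 1\<close>, \<open>2 * k = 1\<close> and \<open>\<i> * \<i> = - 1\<close>.\<close>
  define b where "b = inverse c"
  have cb: "c * b = 1" using c by (simp add: b_def)
  define k :: complex where "k = inverse 2"
  have k2: "2 * k = 1" by (simp add: k_def)
  define u1 u2 w1 w2 where uw: "u1 = complex_of_real (Re u)" "u2 = complex_of_real (Im u)"
    "w1 = complex_of_real (Re w)" "w2 = complex_of_real (Im w)"
  have uw': "u = u1 + \<i> * u2" "cnj u = u1 - \<i> * u2" "w = w1 + \<i> * w2" "cnj w = w1 - \<i> * w2"
    by (simp_all add: uw complex_eq_iff)
  have ii: "\<i> * \<i> = -1" by simp
  have du: "d u v $ i $ j = u1 * d 1 v $ i $ j + u2 * d \<i> v $ i $ j"
    "d w v $ i $ j = w1 * d 1 v $ i $ j + w2 * d \<i> v $ i $ j" if "v \<in> Basis" for v i j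
    unfolding d[OF that, of u] d[OF that, of w] vector_add_component vector_scaleR_component
    by (simp_all add: uw scaleR_conv_of_real)
  note du = du[OF B(1)] du[OF B(2)]
  show ?thesis
    unfolding ext br bracket_def vec_eq_iff forall_2 vector_add_component vector_minus_component
      matrix_matrix_mult_def sum_2 vec_lambda_beta loop_value_entries du mc el zero_index
    unfolding A22 uw[symmetric] b_def[symmetric] k_def[symmetric]
    unfolding uw'(2,4)
    unfolding uw'(1,3)
    using cb ii k2
    by (intro conjI; algebra)
qed

end

theorem proposition7p2:
  fixes D :: "complex set"
    and F :: "complex \<Rightarrow> cmat2 \<times> cmat2"
    and \<Phi> :: "complex \<Rightarrow> cmat2"
  assumes "open D" "connected D" "D \<noteq> {}" "simply_connected D"
    and "harmonic_on D F" and "legendre_on D F"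
    and "frame_on D \<Phi> F"
  shows "\<forall>c::complex. c \<noteq> 0 \<longrightarrow>
    (\<forall>z\<in>D. \<forall>u w.
       ext_deriv (loop_form c (mc_form \<Phi>)) z u w
       + (1/2) *\<^sub>R wedge_bracket (loop_form c (mc_form \<Phi>)) (loop_form c (mc_form \<Phi>)) z u w = 0)"
proof -
  interpret legendre_harmonic_frame D \<Phi> F
    by unfold_locales (use assms in \<open>auto simp: frame_on_def\<close>)
  show ?thesis using loop_form_flat by blast
qed

end
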